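(* Let $K$ be a field and let $n,d,c$ be integers with $1\le c\leq d\leq (n-1)c$. Let $I_{n,d,c}\subset K[x_1,\ldots,x_n]$ be the corresponding ideal of Veronese type. Then $I_{n,d,c}$ is of linear type if $(d,c)=(n-1,1)$ or $(d,c)=(1,1)$, and otherwise \[ C(I_{n,d,c})=I_{n,p+1,1},\quad\text{where } p=\left\lfloor \frac{d-2}{c}\right\rfloor . \]
   Context: All rings are commutative with unit. The bounded Veronese ideal (ideal of Veronese type) $I_{n,d,c}\subseteq K[x_1,\ldots,x_n]$ is the ideal generated by all monomials $x_1^{\alpha_1}\cdots x_n^{\alpha_n}$ with $\alpha_1+\cdots+\alpha_n=d$ and $\alpha_i\le c$ for all $i$. For a Noetherian ring $R$ and an ideal $I=(f_1,\ldots,f_m)\subseteq R$, let $\mathcal{R}(I)=R[f_1t,\ldots,f_mt]\subseteq R[t]$ be the Rees algebra, $T=R[y_1,\ldots,y_m]$ a polynomial ring, $\varphi:T\to\mathcal{R}(I)$ the $R$-algebra homomorphism with $\varphi(y_j)=f_jt$, and $J=\ker\varphi$. Let $L\subseteq J$ be the ideal of $T$ generated by all linear relations $\sum_{i=1}^m a_iy_i$ with $a_i\in R$ and $\sum_i a_if_i=0$. Then $T/L\cong S(I)$ is the symmetric algebra of $I$, and the kernel of the canonical epimorphism $\alpha:S(I)\to\mathcal{R}(I)$ is $J/L$. The conductor of $I$ is the ideal $C(I)=L:_RJ=\{r\in R: rJ\subseteq L\}=\mathrm{Ann}_R(\ker\alpha)$ of $R$; it does not depend on the chosen generators. The ideal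 $I$ is of linear type if $J=L$, equivalently $C(I)=R$. *)

theory Defs
  imports "HOL-Library.Poly_Mapping" "HOL-Library.Cardinality" "HOL-Computational_Algebra.Polynomial"
begin

(* Polynomials with coefficients in 'a and one variable for each element of the type 'v.
   For a finite type 'v with n elements this is the polynomial ring in n variables. *)
type_synonym ('v, 'a) mpol = "('v \<Rightarrow>\<^sub>0 nat) \<Rightarrow>\<^sub>0 'a"

definition mconst :: "'a::comm_ring_1 \<Rightarrow> ('v, 'a) mpol" where
  "mconst a = Poly_Mapping.single 0 a"

definition mvar :: "'v \<Rightarrow> ('v, 'a::comm_ring_1) mpol" where
  "mvar v = Poly_Mapping.single (Poly_Mapping.single v 1) 1"

(* The ideal generated by S, that is, the submodule spanned by S in the ring seen as a module
   over itself. *)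
abbreviation ideal_gen :: "'a::comm_ring_1 set \<Rightarrow> 'a set" where
  "ideal_gen \<equiv> module.span ((*) :: 'a \<Rightarrow> 'a \<Rightarrow> 'a)"

lemma module_ring_self: "module ((*) :: 'a::comm_ring_1 \<Rightarrow> 'a \<Rightarrow> 'a)"
  by unfold_locales (simp_all add: algebra_simps)

(* The ideal of Veronese type; the number of variables is the number of elements of 'n. *)
definition veronese :: "nat \<Rightarrow> nat \<Rightarrow> ('n::finite, 'k::field) mpol set" where
  "veronese d c = ideal_gen
     {\<Prod>i\<in>UNIV. mvar i ^ \<alpha> i | \<alpha> :: 'n \<Rightarrow> nat. (\<Sum>i\<in>UNIV. \<alpha> i) = d \<and> (\<forall>i. \<alpha> i \<le> c)}"

(* In the following an ideal (f_1, ..., f_m) of a ring R = 'a is given by the family f of its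
   generators, whose index type 'm has m elements; T = R[y_1, ..., y_m] is the type
   ('m, 'a) mpol, and R[t] is the type 'a poly. *)

(* The R-algebra homomorphism from T to R[t] that sends y_j to f_j t; its image is the Rees
   algebra. It is characterized by rees_hom_mconst, _mvar, _add and _mult. *)
definition rees_hom :: "('m::finite \<Rightarrow> 'a::comm_ring_1) \<Rightarrow> ('m, 'a) mpol \<Rightarrow> 'a poly" where
  "rees_hom f F = (\<Sum>\<beta>\<in>Poly_Mapping.keys F.
     [:Poly_Mapping.lookup F \<beta>:] * (\<Prod>j\<in>UNIV. [:0, f j:] ^ Poly_Mapping.lookup \<beta> j))"

lemma rees_hom_superset:
  assumes "finite A" "Poly_Mapping.keys F \<subseteq> A"
  shows "rees_hom f F = (\<Sum>\<beta>\<in>A.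
     [:Poly_Mapping.lookup F \<beta>:] * (\<Prod>j\<in>UNIV. [:0, f j:] ^ Poly_Mapping.lookup \<beta> j))"
  unfolding rees_hom_def using assms
  by (intro sum.mono_neutral_left) (auto simp: in_keys_iff)

lemma rees_hom_single:
  "rees_hom f (Poly_Mapping.single \<beta> a) =
     [:a:] * (\<Prod>j\<in>UNIV. [:0, f j:] ^ Poly_Mapping.lookup \<beta> j)"
  by (subst rees_hom_superset[where A = "{\<beta>}"]) simp_all

lemma rees_hom_mconst: "rees_hom f (mconst a) = [:a:]"
  by (simp add: mconst_def rees_hom_single)

lemma rees_hom_mvar: "rees_hom f (mvar j) = [:0, f j:]"
proof -
  have "(\<Prod>i\<in>UNIV. [:0, f i:] ^ Poly_Mapping.lookup (Poly_Mapping.single j 1) i)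
      = (\<Prod>i\<in>UNIV. if i = j then [:0, f i:] else 1)"
    by (intro prod.cong) (auto simp: lookup_single)
  then show ?thesis
    by (simp add: mvar_def rees_hom_single)
qed

lemma rees_hom_add: "rees_hom f (F + G) = rees_hom f F + rees_hom f G"
proof -
  let ?A = "Poly_Mapping.keys F \<union> Poly_Mapping.keys G"
  have "finite ?A" "Poly_Mapping.keys (F + G) \<subseteq> ?A"
    using keys_add[of F G] by auto
  then show ?thesis
    by (simp add: rees_hom_superset[where A = ?A] lookup_add sum.distrib [symmetric]
        ring_distribs [symmetric] del: mult_pCons_left)
qed

lemma mpol_sum_singles:
  "F = (\<Sum>\<beta>\<in>Poly_Mapping.keys F. Poly_Mapping.single \<beta> (Poly_Mapping.lookup F \<beta>))"
  by (intro poly_mapping_eqI)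
     (auto simp: lookup_sum lookup_single when_def in_keys_iff)

lemma rees_hom_mult:
  fixes f :: "'m::finite \<Rightarrow> 'a::comm_ring_1"
  shows "rees_hom f (F * G) = rees_hom f F * rees_hom f G"
proof -
  have zero: "rees_hom f 0 = 0"
    by (simp add: rees_hom_def)
  have sum: "rees_hom f (sum h A) = (\<Sum>x\<in>A. rees_hom f (h x))"
    for h and A :: "('m \<Rightarrow>\<^sub>0 nat) set"
    by (induction A rule: infinite_finite_induct) (simp_all add: rees_hom_add zero)
  have single: "rees_hom f (Poly_Mapping.single \<beta> a * Poly_Mapping.single \<gamma> b)
      = rees_hom f (Poly_Mapping.single \<beta> a) * rees_hom f (Poly_Mapping.single \<gamma> b)"
    for \<beta> \<gamma> a b
  proof -
    have c: "[:a * b:] = [:a:] * [:b:]" by simp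
    show ?thesis
      by (simp only: mult_single rees_hom_single lookup_add power_add prod.distrib c mult_ac)
  qed
  have "rees_hom f (sum g A * sum h B) = rees_hom f (sum g A) * rees_hom f (sum h B)"
    if "\<And>x y. rees_hom f (g x * h y) = rees_hom f (g x) * rees_hom f (h y)"
    for g h and A B :: "('m \<Rightarrow>\<^sub>0 nat) set"
    by (simp only: sum_product sum that)
  note * = this[where g = "\<lambda>\<beta>. Poly_Mapping.single \<beta> (Poly_Mapping.lookup F \<beta>)"
      and h = "\<lambda>\<beta>. Poly_Mapping.single \<beta> (Poly_Mapping.lookup G \<beta>)"
      and A = "Poly_Mapping.keys F" and B = "Poly_Mapping.keys G", OF single]
  show ?thesis
    using * unfolding mpol_sum_singles[symmetric] .
qed

(* J, the defining ideal of the Rees algebra. *)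
definition rees_ideal :: "('m::finite \<Rightarrow> 'a::comm_ring_1) \<Rightarrow> ('m, 'a) mpol set" where
  "rees_ideal f = {F. rees_hom f F = 0}"

(* L, the defining ideal of the symmetric algebra. *)
definition sym_ideal :: "('m::finite \<Rightarrow> 'a::comm_ring_1) \<Rightarrow> ('m, 'a) mpol set" where
  "sym_ideal f = ideal_gen {\<Sum>i\<in>UNIV. mconst (a i) * mvar i | a. (\<Sum>i\<in>UNIV. a i * f i) = 0}"

definition conductor :: "('m::finite \<Rightarrow> 'a::comm_ring_1) \<Rightarrow> 'a set" where
  "conductor f = {r. \<forall>F\<in>rees_ideal f. mconst r * F \<in> sym_ideal f}"

definition linear_type :: "('m::finite \<Rightarrow> 'a::comm_ring_1) \<Rightarrow> bool" where
  "linear_type f \<longleftrightarrow> rees_ideal f = sym_ideal f"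

end

theory Submission
  imports Defs "HOL-Library.Multiset"
begin

text \<open>Modulo linear relations, \<open>T = R[y]\<close> is spanned over \<open>K\<close> by products \<open>x^b y\<^sub>g\<^sub>1 \<dots> y\<^sub>g\<^sub>k\<close>,
  where \<open>y\<^sub>g\<close> belongs to the monomial generator \<open>x^g\<close>. Two products with the same image in the Rees
  algebra are connected by linear moves \<open>x^b y\<^sub>g \<rightarrow> x^b' y\<^sub>g\<^sub>'\<close> with \<open>b + g = b' + g'\<close> and by quadratic
  exchanges \<open>y\<^sub>g y\<^sub>h \<rightarrow> y\<^sub>g\<^sub>' y\<^sub>h\<^sub>'\<close>, where \<open>g' = g - e\<^sub>i + e\<^sub>j\<close> and \<open>h' = h + e\<^sub>i - e\<^sub>j\<close>. After multiplication
  by \<open>x\<^sub>s\<close> with \<open>g\<^sub>s < c\<close>, an exchange is a composition of linear moves; if \<open>c |S| \<ge> d - 1\<close>, then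
  some \<open>s\<close> in \<open>S\<close> works unless the exchange is a mere swap. Hence \<open>x\<^sub>S\<close> lies in the conductor. If \<open>c = 1\<close> and
  \<open>d = n - 1\<close>, all exchanges are swaps, and \<open>S\<close> may be empty. For arbitrary generators \<open>f\<^sub>j\<close>, the role of
  \<open>y\<^sub>g\<close> is played by a linear form \<open>gen g\<close> that comes from an expression of \<open>x^g\<close> in the \<open>f\<^sub>j\<close>.

  Conversely, let \<open>A\<close> be the support of a monomial with \<open>c |A| \<le> d - 2\<close>. Choose \<open>x^g x^h = x^g' x^h'\<close>
  with \<open>g\<close> and \<open>h\<close> equal to \<open>c\<close> on \<open>A\<close> and \<open>g'\<close> different from both. The ring homomorphism
  that sets the variables outside \<open>A\<close> to zero, sends \<open>y\<^sub>g\<close> and \<open>y\<^sub>h\<close> to 1 and the other \<open>y\<^sub>k\<close> to 0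
  is well defined on the symmetric algebra and maps \<open>r (y\<^sub>g y\<^sub>h - y\<^sub>g\<^sub>' y\<^sub>h\<^sub>')\<close> to the restriction of \<open>r\<close>
  to \<open>A\<close>, which therefore vanishes for \<open>r\<close> in the conductor.\<close>

section \<open>Connecting products of generators with the same image\<close>

abbreviation unit_exp :: "'v \<Rightarrow> 'v \<Rightarrow>\<^sub>0 nat" where
  "unit_exp i \<equiv> Poly_Mapping.single i (Suc 0)"

abbreviation exp_deg :: "('v::finite \<Rightarrow>\<^sub>0 nat) \<Rightarrow> nat" where
  "exp_deg a \<equiv> \<Sum>i\<in>UNIV. Poly_Mapping.lookup a i"

definition bounded_exps :: "nat \<Rightarrow> nat \<Rightarrow> ('n::finite \<Rightarrow>\<^sub>0 nat) set" where
  "bounded_exps d c = {a. exp_deg a = d \<and> (\<forall>i. Poly_Mapping.lookup a i \<le> c)}"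

lemma bounded_expsD:
  assumes "a \<in> bounded_exps d c"
  shows "exp_deg a = d" "Poly_Mapping.lookup a i \<le> c"
  using assms by (auto simp: bounded_exps_def)

lemma finite_bounded_exps: "finite (bounded_exps d c :: ('n::finite \<Rightarrow>\<^sub>0 nat) set)"
proof (rule finite_subset)
  let ?F = "{h :: 'n \<Rightarrow> nat. \<forall>x. (x \<in> UNIV \<longrightarrow> h x \<in> {..c}) \<and> (x \<notin> UNIV \<longrightarrow> h x = 0)}"
  show "bounded_exps d c \<subseteq> Abs_poly_mapping ` ?F"
  proof
    fix a :: "'n \<Rightarrow>\<^sub>0 nat" assume "a \<in> bounded_exps d c"
    then have "Poly_Mapping.lookup a \<in> ?F"
      by (auto dest: bounded_expsD(2))
    then have "Abs_poly_mapping (Poly_Mapping.lookup a) \<in> Abs_poly_mapping ` ?F"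
      by (rule imageI)
    then show "a \<in> Abs_poly_mapping ` ?F"
      by (simp only: poly_mapping.lookup_inverse)
  qed
  show "finite (Abs_poly_mapping ` ?F)"
    by (intro finite_imageI finite_set_of_finite_funs) simp_all
qed

lemma lookup_unit_exp: "Poly_Mapping.lookup (unit_exp i) j = (if i = j then 1 else 0)"
  by (auto simp: lookup_single)

lemma exp_deg_unit_exp: "exp_deg (unit_exp (i :: 'n::finite)) = 1"
  by (simp only: lookup_unit_exp) simp

text \<open>The step from x^g to x^g x_j / x_i. It is stated as an equation of sums because
  subtraction of exponents truncates; positivity of g at i makes it exact.\<close>

lemma bounded_exps_exchange:
  fixes g :: "'n::finite \<Rightarrow>\<^sub>0 nat"
  assumes "g \<in> bounded_exps d c" "0 < Poly_Mapping.lookup g i" "Poly_Mapping.lookup g j < c"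
  obtains g' where "g' \<in> bounded_exps d c" "g + unit_exp j = g' + unit_exp i"
proof -
  define g' where "g' = g + unit_exp j - unit_exp i"
  have eq: "g + unit_exp j = g' + unit_exp i"
  proof (rule poly_mapping_eqI)
    fix l
    show "Poly_Mapping.lookup (g + unit_exp j) l = Poly_Mapping.lookup (g' + unit_exp i) l"
      using assms(2) by (auto simp: g'_def lookup_add lookup_minus lookup_unit_exp)
  qed
  have "exp_deg (g + unit_exp j) = exp_deg (g' + unit_exp i)"
    by (simp only: eq)
  then have "exp_deg g' = d"
    using assms(1) exp_deg_unit_exp[of i] exp_deg_unit_exp[of j]
    by (simp add: lookup_add sum.distrib bounded_exps_def)
  moreover have "Poly_Mapping.lookup g' l \<le> c" for l
    using assms(3) bounded_expsD(2)[OF assms(1), of l]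
    by (auto simp: g'_def lookup_add lookup_minus lookup_unit_exp)
  ultimately have "g' \<in> bounded_exps d c" by (simp add: bounded_exps_def)
  with eq that show ?thesis by blast
qed

lemma exp_deg_exchange:
  fixes a b :: "'n::finite \<Rightarrow>\<^sub>0 nat"
  assumes "exp_deg a = exp_deg b" "Poly_Mapping.lookup a i > Poly_Mapping.lookup b i"
  obtains j where "Poly_Mapping.lookup a j < Poly_Mapping.lookup b j"
proof -
  have "\<exists>j. Poly_Mapping.lookup a j < Poly_Mapping.lookup b j"
  proof (rule ccontr)
    assume "\<not> ?thesis"
    then have "exp_deg b < exp_deg a"
      using assms(2) by (intro sum_strict_mono_ex1) (auto simp: not_less)
    with assms(1) show False by simp
  qed
  with that show ?thesis by blast
qed

lemma exp_deg_eq_imp_eq: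
  fixes a b :: "'n::finite \<Rightarrow>\<^sub>0 nat"
  assumes "exp_deg a = exp_deg b" "\<And>i. Poly_Mapping.lookup a i \<le> Poly_Mapping.lookup b i"
  shows "a = b"
proof (rule poly_mapping_eqI)
  fix i
  show "Poly_Mapping.lookup a i = Poly_Mapping.lookup b i"
    using exp_deg_exchange[of b a i] assms by (metis le_neq_implies_less not_less)
qed

lemma exp_deg_sum_mset:
  fixes M :: "('n::finite \<Rightarrow>\<^sub>0 nat) multiset"
  assumes "set_mset M \<subseteq> bounded_exps d c"
  shows "exp_deg (\<Sum>\<^sub># M) = size M * d"
  using assms
  by (induction M) (auto simp: lookup_add sum.distrib dest: bounded_expsD(1))

lemma lookup_sum_mset_le:
  fixes M :: "('n::finite \<Rightarrow>\<^sub>0 nat) multiset"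
  assumes "set_mset M \<subseteq> bounded_exps d c"
  shows "Poly_Mapping.lookup (\<Sum>\<^sub># M) i \<le> size M * c"
  using assms
proof (induction M)
  case (add g M)
  then show ?case using bounded_expsD(2)[of g d c i] by (simp add: lookup_add)
qed simp

lemma lookup_sum_mset_ge:
  fixes M :: "('n::finite \<Rightarrow>\<^sub>0 nat) multiset"
  assumes "\<And>g. g \<in># M \<Longrightarrow> Poly_Mapping.lookup g i \<ge> c"
  shows "Poly_Mapping.lookup (\<Sum>\<^sub># M) i \<ge> size M * c"
  using assms
proof (induction M)
  case (add g M)
  from add.prems[of g] add.prems add.IH show ?case by (simp add: lookup_add add_mono)
qed simp

text \<open>Otherwise every member of \<open>M\<close> has exponent at least c at i, and the sum of
  \<open>M'\<close>, with equally many members bounded by c, could not be larger there.\<close>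

lemma ex_lookup_less_bound:
  fixes M :: "('n::finite \<Rightarrow>\<^sub>0 nat) multiset"
  assumes "set_mset M' \<subseteq> bounded_exps d c" "size M = size M'"
    and "Poly_Mapping.lookup (\<Sum>\<^sub># M) i < Poly_Mapping.lookup (\<Sum>\<^sub># M') i"
  obtains g where "g \<in># M" "Poly_Mapping.lookup g i < c"
  using assms lookup_sum_mset_le[of M' d c i] lookup_sum_mset_ge[of M c i]
  by (metis leD le_less_trans not_le_imp_less order.strict_trans1)

lemma ex_lookup_pos:
  fixes M :: "('n::finite \<Rightarrow>\<^sub>0 nat) multiset"
  assumes "0 < Poly_Mapping.lookup (\<Sum>\<^sub># M) i"
  obtains g where "g \<in># M" "0 < Poly_Mapping.lookup g i"
proof -
  have "\<exists>g. g \<in># M \<and> 0 < Poly_Mapping.lookup g i"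
    using assms by (induction M) (simp, fastforce simp: lookup_add)
  with that show ?thesis by blast
qed

section \<open>Connectivity of products with the same image\<close>

text \<open>A pair \<open>(b, M)\<close> stands for the monomial with coefficient monomial \<open>x^b\<close> and one variable
  \<open>y\<^sub>g\<close> for each \<open>g\<close> in \<open>M\<close>, where \<open>y\<^sub>g\<close> belongs to the generator \<open>x^g\<close>.\<close>

inductive conn :: "nat \<Rightarrow> nat \<Rightarrow> ('n::finite \<Rightarrow>\<^sub>0 nat) \<Rightarrow> ('n \<Rightarrow>\<^sub>0 nat) multiset
    \<Rightarrow> ('n \<Rightarrow>\<^sub>0 nat) \<Rightarrow> ('n \<Rightarrow>\<^sub>0 nat) multiset \<Rightarrow> bool" for d c where
  refl: "conn d c b M b M"
| linear: "g \<in> bounded_exps d c \<Longrightarrow> g' \<in> bounded_exps d c \<Longrightarrow> b + g = b' + g' \<Longrightarrow>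
    conn d c b {#g#} b' {#g'#}"
| quadratic: "g \<in> bounded_exps d c \<Longrightarrow> g' \<in> bounded_exps d c \<Longrightarrow>
    h \<in> bounded_exps d c \<Longrightarrow> h' \<in> bounded_exps d c \<Longrightarrow>
    g + unit_exp j = g' + unit_exp i \<Longrightarrow> h + unit_exp i = h' + unit_exp j \<Longrightarrow>
    conn d c 0 {#g, h#} 0 {#g', h'#}"
| trans: "conn d c b M b' M' \<Longrightarrow> conn d c b' M' b'' M'' \<Longrightarrow> conn d c b M b'' M''"
| cong: "conn d c b M b' M' \<Longrightarrow> set_mset N \<subseteq> bounded_exps d c \<Longrightarrow>
    conn d c (v + b) (N + M) (v + b') (N + M')"

text \<open>Provides a single generator that can take x_s and give x_t, when \<open>l\<close> can do
  the first and \<open>l'\<close> the second. If neither can do both, then \<open>l\<close> misses t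
  and \<open>l'\<close> is full at s. One quadratic exchange moves x_s from \<open>l'\<close> to
  \<open>l\<close> in return for some x_r; the resulting \<open>k'\<close> has room at s and still
  contains x_t.\<close>

lemma conn_exchange:
  fixes M :: "('n::finite \<Rightarrow>\<^sub>0 nat) multiset"
  assumes M: "set_mset M \<subseteq> bounded_exps d c" and "s \<noteq> t"
    and l: "l \<in># M" "Poly_Mapping.lookup l s < c"
    and l': "l' \<in># M" "0 < Poly_Mapping.lookup l' t"
  obtains g N where "conn d c 0 M 0 (add_mset g N)" "set_mset (add_mset g N) \<subseteq> bounded_exps d c"
    "Poly_Mapping.lookup g s < c" "0 < Poly_Mapping.lookup g t"
    "\<Sum>\<^sub># M = g + \<Sum>\<^sub># N" "size M = Suc (size N)"
proof (cases "0 < Poly_Mapping.lookup l t \<or> Poly_Mapping.lookup l' s < c")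
  case True
  then obtain g where g: "g \<in># M" "Poly_Mapping.lookup g s < c" "0 < Poly_Mapping.lookup g t"
    using l l' by blast
  then obtain N where "M = add_mset g N" by (meson mset_add)
  with g M that[of g N] show ?thesis by (simp add: conn.refl)
next
  case False
  then have t: "Poly_Mapping.lookup l t = 0" and s: "c \<le> Poly_Mapping.lookup l' s" by auto
  have B: "l \<in> bounded_exps d c" "l' \<in> bounded_exps d c" using M l l' by auto
  obtain r where r: "Poly_Mapping.lookup l' r < Poly_Mapping.lookup l r"
  proof (rule exp_deg_exchange)
    show "exp_deg l' = exp_deg l" using B by (simp add: bounded_expsD(1))
    show "Poly_Mapping.lookup l s < Poly_Mapping.lookup l' s" using s l(2) by simp
  qed
  have rc: "Poly_Mapping.lookup l' r < c"
    using r bounded_expsD(2)[OF B(1), of r] by simp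
  \<comment> \<open>\<open>l'\<close> exceeds \<open>l\<close> at both s and t, whereas
    \<open>l\<close> exceeds \<open>l'\<close> at r.\<close>
  have neq: "r \<noteq> s" "r \<noteq> t" using r t s l by auto
  obtain k' where k': "k' \<in> bounded_exps d c" "l' + unit_exp r = k' + unit_exp s"
    by (rule bounded_exps_exchange[OF B(2) _ rc, of s]) (use s l(2) in auto)
  obtain k where k: "k \<in> bounded_exps d c" "l + unit_exp s = k + unit_exp r"
    by (rule bounded_exps_exchange[OF B(1) _ l(2), of r]) (use r in auto)
  have "l \<noteq> l'" using r by auto
  obtain N1 where N1: "M = add_mset l' N1" using l'(1) by (meson mset_add)
  then have "l \<in># N1" using l(1) \<open>l \<noteq> l'\<close> by auto
  then obtain N where "N1 = add_mset l N" by (meson mset_add)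
  with N1 have N: "M = {#l', l#} + N" by simp
  have "conn d c (0 + 0) (N + {#l', l#}) (0 + 0) (N + {#k', k#})"
    by (rule conn.cong[OF conn.quadratic[OF B(2) k'(1) B(1) k(1) k'(2) k(2)]]) (use M N in auto)
  then have c1: "conn d c 0 M 0 (add_mset k' (add_mset k N))"
    using N by (simp add: add_mset_commute)
  have kl: "Poly_Mapping.lookup k' x + (if s = x then 1 else 0)
      = Poly_Mapping.lookup l' x + (if r = x then 1 else 0)" for x
    using arg_cong[OF k'(2), of "\<lambda>p. Poly_Mapping.lookup p x"] by (simp add: lookup_add lookup_unit_exp)
  have "Poly_Mapping.lookup k' s < c" "0 < Poly_Mapping.lookup k' t"
    using kl[of s] kl[of t] neq l' \<open>s \<noteq> t\<close> bounded_expsD(2)[OF B(2), of s] by auto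
  moreover have "l' + l = k' + k"
  proof -
    have "(l' + l) + (unit_exp r + unit_exp s) = (k' + k) + (unit_exp r + unit_exp s)"
      using arg_cong2[OF k'(2) k(2), of "(+)"] by (simp add: ac_simps)
    then show ?thesis by simp
  qed
  then have "\<Sum>\<^sub># M = k' + \<Sum>\<^sub># (add_mset k N)"
    using N by (simp add: add.assoc[symmetric])
  ultimately show ?thesis
    using that[OF c1] M N k k' by auto
qed

text \<open>Induction on the excess of b over b'. If b exceeds b' at s, equal degrees give t where
  b' exceeds b. A linear move trades x_s in the coefficient for x_t from a generator, which lowers
  the excess.\<close>

lemma conn_coefficient:
  fixes b b' :: "'n::finite \<Rightarrow>\<^sub>0 nat"
  assumes "set_mset M \<subseteq> bounded_exps d c" "set_mset M' \<subseteq> bounded_exps d c"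
    and "size M = size M'" "b + \<Sum>\<^sub># M = b' + \<Sum>\<^sub># M'"
  shows "\<exists>N. conn d c b M b' N \<and> set_mset N \<subseteq> bounded_exps d c \<and> size N = size M \<and>
    \<Sum>\<^sub># N = \<Sum>\<^sub># M'"
  using assms
proof (induction "\<Sum>i\<in>UNIV. Poly_Mapping.lookup b i - Poly_Mapping.lookup b' i"
    arbitrary: b M rule: less_induct)
  case less
  have lk: "Poly_Mapping.lookup b i + Poly_Mapping.lookup (\<Sum>\<^sub># M) i
      = Poly_Mapping.lookup b' i + Poly_Mapping.lookup (\<Sum>\<^sub># M') i" for i
    using arg_cong[OF less.prems(4), of "\<lambda>p. Poly_Mapping.lookup p i"] by (simp add: lookup_add)
  have "exp_deg b + exp_deg (\<Sum>\<^sub># M) = exp_deg b' + exp_deg (\<Sum>\<^sub># M')"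
    by (simp only: sum.distrib[symmetric] lk)
  then have deg: "exp_deg b = exp_deg b'"
    using exp_deg_sum_mset[OF less.prems(1)] exp_deg_sum_mset[OF less.prems(2)] less.prems(3) by simp
  show ?case
  proof (cases "\<exists>s. Poly_Mapping.lookup b' s < Poly_Mapping.lookup b s")
    case False
    then have "b = b'" using exp_deg_eq_imp_eq[OF deg] by (simp add: not_less)
    with less.prems show ?thesis by (auto intro!: exI[of _ M] conn.refl)
  next
    case True
    then obtain s where s: "Poly_Mapping.lookup b' s < Poly_Mapping.lookup b s" by blast
    obtain t where t: "Poly_Mapping.lookup b t < Poly_Mapping.lookup b' t"
      using exp_deg_exchange[OF deg s] by blast
    have "s \<noteq> t" using s t by auto
    \<comment> \<open>What b has in excess at s is missing in \<open>M\<close>, so some member of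
      \<open>M\<close> can take x_s; dually, some member can give x_t.\<close>
    have "Poly_Mapping.lookup (\<Sum>\<^sub># M) s < Poly_Mapping.lookup (\<Sum>\<^sub># M') s"
      using lk[of s] s by linarith
    then obtain l where l: "l \<in># M" "Poly_Mapping.lookup l s < c"
      by (rule ex_lookup_less_bound[OF less.prems(2,3)])
    have "0 < Poly_Mapping.lookup (\<Sum>\<^sub># M) t"
      using lk[of t] t by linarith
    then obtain l' where l': "l' \<in># M" "0 < Poly_Mapping.lookup l' t"
      by (rule ex_lookup_pos)
    obtain g N where gN: "conn d c 0 M 0 (add_mset g N)"
      "set_mset (add_mset g N) \<subseteq> bounded_exps d c"
      "Poly_Mapping.lookup g s < c" "0 < Poly_Mapping.lookup g t"
      "\<Sum>\<^sub># M = g + \<Sum>\<^sub># N" "size M = Suc (size N)"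
      by (rule conn_exchange[OF less.prems(1) \<open>s \<noteq> t\<close> l l'])
    obtain g' where g': "g' \<in> bounded_exps d c" "g + unit_exp s = g' + unit_exp t"
      by (rule bounded_exps_exchange[of g d c t s]) (use gN in auto)
    define b1 where "b1 = b - unit_exp s"
    have b: "b = b1 + unit_exp s"
      by (rule poly_mapping_eqI)
        (use s in \<open>auto simp: b1_def lookup_add lookup_minus lookup_unit_exp\<close>)
    have c1: "conn d c (b + 0) ({#} + M) (b + 0) ({#} + add_mset g N)"
      by (rule conn.cong[OF gN(1)]) simp
    have c2: "conn d c (b1 + unit_exp s) (N + {#g#}) (b1 + unit_exp t) (N + {#g'#})"
      by (rule conn.cong[OF conn.linear]) (use gN g' in \<open>auto simp: add.commute\<close>)
    have c12: "conn d c b M (b1 + unit_exp t) (add_mset g' N)"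
      using conn.trans[of d c "b + 0" "{#} + M" "b + 0" "{#} + add_mset g N"] c1 c2 b by simp
    have lkb: "Poly_Mapping.lookup (b1 + unit_exp t) x + (if s = x then 1 else 0)
        = Poly_Mapping.lookup b x + (if t = x then 1 else 0)" for x
      by (simp add: b lookup_add lookup_unit_exp)
    have small: "(\<Sum>i\<in>UNIV. Poly_Mapping.lookup (b1 + unit_exp t) i - Poly_Mapping.lookup b' i)
        < (\<Sum>i\<in>UNIV. Poly_Mapping.lookup b i - Poly_Mapping.lookup b' i)"
    proof (rule sum_strict_mono_ex1)
      show "\<forall>x\<in>UNIV. Poly_Mapping.lookup (b1 + unit_exp t) x - Poly_Mapping.lookup b' x
          \<le> Poly_Mapping.lookup b x - Poly_Mapping.lookup b' x"
      proof
        fix x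
        show "Poly_Mapping.lookup (b1 + unit_exp t) x - Poly_Mapping.lookup b' x
          \<le> Poly_Mapping.lookup b x - Poly_Mapping.lookup b' x"
          using lkb[of x] t by (auto split: if_splits)
      qed
      show "\<exists>x\<in>UNIV. Poly_Mapping.lookup (b1 + unit_exp t) x - Poly_Mapping.lookup b' x
          < Poly_Mapping.lookup b x - Poly_Mapping.lookup b' x"
        using lkb[of s] s \<open>s \<noteq> t\<close> by (intro bexI[of _ s]) auto
    qed simp
    have e: "b1 + unit_exp t + \<Sum>\<^sub># (add_mset g' N) = b' + \<Sum>\<^sub># M'"
    proof -
      have "b1 + unit_exp t + \<Sum>\<^sub># (add_mset g' N) = b1 + (g' + unit_exp t) + \<Sum>\<^sub># N"
        by (simp add: ac_simps)
      also have "\<dots> = b + \<Sum>\<^sub># M"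
        unfolding g'(2)[symmetric] using gN(5) b by (simp add: ac_simps)
      finally show ?thesis using less.prems(4) by simp
    qed
    have "set_mset (add_mset g' N) \<subseteq> bounded_exps d c" "size (add_mset g' N) = size M'"
      using gN g' less.prems(3) by auto
    from less.hyps[OF small this(1) less.prems(2) this(2) e] obtain N'
      where "conn d c (b1 + unit_exp t) (add_mset g' N) b' N'" "set_mset N' \<subseteq> bounded_exps d c"
        "size N' = size M" "\<Sum>\<^sub># N' = \<Sum>\<^sub># M'" using gN(6) by auto
    with conn.trans[OF c12] show ?thesis by blast
  qed
qed

text \<open>The same induction with g in place of the coefficient: a quadratic exchange with a
  member k of the rest moves g towards h. The room of g at j comes from the bound on h.\<close>

lemma conn_replace:
  fixes g :: "'n::finite \<Rightarrow>\<^sub>0 nat"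
  assumes "set_mset (add_mset g M) \<subseteq> bounded_exps d c" "set_mset (add_mset h M') \<subseteq> bounded_exps d c"
    and "size M = size M'" "g + \<Sum>\<^sub># M = h + \<Sum>\<^sub># M'"
  shows "\<exists>N. conn d c 0 (add_mset g M) 0 (add_mset h N) \<and> set_mset N \<subseteq> bounded_exps d c \<and>
    size N = size M \<and> \<Sum>\<^sub># N = \<Sum>\<^sub># M'"
  using assms
proof (induction "\<Sum>i\<in>UNIV. Poly_Mapping.lookup g i - Poly_Mapping.lookup h i"
    arbitrary: g M rule: less_induct)
  case less
  have lk: "Poly_Mapping.lookup g i + Poly_Mapping.lookup (\<Sum>\<^sub># M) i
      = Poly_Mapping.lookup h i + Poly_Mapping.lookup (\<Sum>\<^sub># M') i" for i
    using arg_cong[OF less.prems(4), of "\<lambda>p. Poly_Mapping.lookup p i"] by (simp add: lookup_add)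
  have B: "g \<in> bounded_exps d c" "h \<in> bounded_exps d c"
    "set_mset M \<subseteq> bounded_exps d c" "set_mset M' \<subseteq> bounded_exps d c"
    using less.prems by auto
  have deg: "exp_deg g = exp_deg h"
    using B by (simp add: bounded_expsD(1))
  show ?case
  proof (cases "\<exists>i. Poly_Mapping.lookup h i < Poly_Mapping.lookup g i")
    case False
    then have "g = h" using exp_deg_eq_imp_eq[OF deg] by (simp add: not_less)
    with less.prems show ?thesis by (auto intro!: exI[of _ M] conn.refl)
  next
    case True
    then obtain i where i: "Poly_Mapping.lookup h i < Poly_Mapping.lookup g i" by blast
    obtain j where j: "Poly_Mapping.lookup g j < Poly_Mapping.lookup h j"
      using exp_deg_exchange[OF deg i] by blast
    have "i \<noteq> j" using i j by auto
    have "Poly_Mapping.lookup (\<Sum>\<^sub># M) i < Poly_Mapping.lookup (\<Sum>\<^sub># M') i"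
      using lk[of i] i by linarith
    then obtain l where l: "l \<in># M" "Poly_Mapping.lookup l i < c"
      by (rule ex_lookup_less_bound[OF B(4) less.prems(3)])
    have "0 < Poly_Mapping.lookup (\<Sum>\<^sub># M) j"
      using lk[of j] j by linarith
    then obtain l' where l': "l' \<in># M" "0 < Poly_Mapping.lookup l' j"
      by (rule ex_lookup_pos)
    obtain k N where kN: "conn d c 0 M 0 (add_mset k N)"
      "set_mset (add_mset k N) \<subseteq> bounded_exps d c"
      "Poly_Mapping.lookup k i < c" "0 < Poly_Mapping.lookup k j"
      "\<Sum>\<^sub># M = k + \<Sum>\<^sub># N" "size M = Suc (size N)"
      by (rule conn_exchange[OF B(3) \<open>i \<noteq> j\<close> l l'])
    obtain g' where g': "g' \<in> bounded_exps d c" "g + unit_exp j = g' + unit_exp i"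
      by (rule bounded_exps_exchange[OF B(1), of i j])
        (use i j bounded_expsD(2)[OF B(2), of j] in auto)
    obtain k' where k': "k' \<in> bounded_exps d c" "k + unit_exp i = k' + unit_exp j"
      by (rule bounded_exps_exchange[of k d c j i]) (use kN in auto)
    have kB: "k \<in> bounded_exps d c" using kN by auto
    have c1: "conn d c (0 + 0) ({#g#} + M) (0 + 0) ({#g#} + add_mset k N)"
      by (rule conn.cong[OF kN(1)]) (use B in auto)
    have c2: "conn d c (0 + 0) (N + {#g, k#}) (0 + 0) (N + {#g', k'#})"
      by (rule conn.cong[OF conn.quadratic[OF B(1) g'(1) kB k'(1) g'(2) k'(2)]]) (use kN in auto)
    have c12: "conn d c 0 (add_mset g M) 0 (add_mset g' (add_mset k' N))"
      using conn.trans[of d c 0 "add_mset g M" 0 "add_mset g (add_mset k N)"] c1 c2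
      by (simp add: add_mset_commute)
    have lkg: "Poly_Mapping.lookup g x + (if j = x then 1 else 0)
        = Poly_Mapping.lookup g' x + (if i = x then 1 else 0)" for x
      using arg_cong[OF g'(2), of "\<lambda>p. Poly_Mapping.lookup p x"]
      by (simp add: lookup_add lookup_unit_exp)
    have small: "(\<Sum>x\<in>UNIV. Poly_Mapping.lookup g' x - Poly_Mapping.lookup h x)
        < (\<Sum>x\<in>UNIV. Poly_Mapping.lookup g x - Poly_Mapping.lookup h x)"
    proof (rule sum_strict_mono_ex1)
      show "\<forall>x\<in>UNIV. Poly_Mapping.lookup g' x - Poly_Mapping.lookup h x
          \<le> Poly_Mapping.lookup g x - Poly_Mapping.lookup h x"
      proof
        fix x
        show "Poly_Mapping.lookup g' x - Poly_Mapping.lookup h x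
          \<le> Poly_Mapping.lookup g x - Poly_Mapping.lookup h x"
          using lkg[of x] j by (auto split: if_splits)
      qed
      show "\<exists>x\<in>UNIV. Poly_Mapping.lookup g' x - Poly_Mapping.lookup h x
          < Poly_Mapping.lookup g x - Poly_Mapping.lookup h x"
        using lkg[of i] i \<open>i \<noteq> j\<close> by (intro bexI[of _ i]) auto
    qed simp
    have "(g + k) + (unit_exp i + unit_exp j) = (g' + k') + (unit_exp i + unit_exp j)"
      using arg_cong2[OF g'(2) k'(2), of "(+)"] by (simp add: ac_simps)
    then have "g' + k' = g + k" by (metis add_right_imp_eq)
    then have e: "g' + \<Sum>\<^sub># (add_mset k' N) = h + \<Sum>\<^sub># M'"
      using less.prems(4) kN(5) by (simp add: add.assoc[symmetric])
    have "set_mset (add_mset g' (add_mset k' N)) \<subseteq> bounded_exps d c"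
      "size (add_mset k' N) = size M'"
      using kN g' k' less.prems(3) by auto
    from less.hyps[OF small this(1) less.prems(2) this(2) e] obtain N'
      where "conn d c 0 (add_mset g' (add_mset k' N)) 0 (add_mset h N')"
        "set_mset N' \<subseteq> bounded_exps d c" "size N' = size M" "\<Sum>\<^sub># N' = \<Sum>\<^sub># M'"
      using kN(6) by auto
    with conn.trans[OF c12] show ?thesis by blast
  qed
qed

text \<open>The members of \<open>M'\<close> are brought in one at a time by
  \<open>conn_replace\<close>; what remains has the size and the sum of the rest of
  \<open>M'\<close>, so induction applies.\<close>

lemma conn_of_sum_eq:
  fixes M :: "('n::finite \<Rightarrow>\<^sub>0 nat) multiset"
  assumes "set_mset M \<subseteq> bounded_exps d c" "set_mset M' \<subseteq> bounded_exps d c"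
    and "size M = size M'" "\<Sum>\<^sub># M = \<Sum>\<^sub># M'"
  shows "conn d c 0 M 0 M'"
  using assms
proof (induction M' arbitrary: M)
  case empty
  then show ?case by (simp add: conn.refl)
next
  case (add h M')
  from add.prems(3) obtain g M0 where M: "M = add_mset g M0"
    by (metis size_eq_Suc_imp_eq_union size_add_mset)
  obtain N where N: "conn d c 0 (add_mset g M0) 0 (add_mset h N)" "set_mset N \<subseteq> bounded_exps d c"
      "size N = size M0" "\<Sum>\<^sub># N = \<Sum>\<^sub># M'"
    using conn_replace[of g M0 d c h M'] add.prems M by auto
  have "conn d c 0 N 0 M'"
    using add.prems N M by (intro add.IH) auto
  then have "conn d c (0 + 0) ({#h#} + N) (0 + 0) ({#h#} + M')"
    by (rule conn.cong) (use add.prems in auto)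
  with conn.trans[OF N(1)] show ?case unfolding M by simp
qed

text \<open>First the coefficient is matched, then the generators. In other words, linear moves and
  quadratic exchanges connect each fibre of the map from states to monomials x^a t^k.\<close>

lemma conn_of_same_image:
  fixes b b' :: "'n::finite \<Rightarrow>\<^sub>0 nat"
  assumes "set_mset M \<subseteq> bounded_exps d c" "set_mset M' \<subseteq> bounded_exps d c"
    and "size M = size M'" "b + \<Sum>\<^sub># M = b' + \<Sum>\<^sub># M'"
  shows "conn d c b M b' M'"
proof -
  obtain N where N: "conn d c b M b' N" "set_mset N \<subseteq> bounded_exps d c" "size N = size M"
      "\<Sum>\<^sub># N = \<Sum>\<^sub># M'"
    using conn_coefficient[OF assms] by blast
  have "conn d c (b' + 0) ({#} + N) (b' + 0) ({#} + M')"
    by (rule conn.cong[OF conn_of_sum_eq]) (use assms N in auto)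
  with conn.trans[OF N(1)] show ?thesis by simp
qed

section \<open>Polynomials, evaluation and linear forms\<close>

lemma mconst_add: "mconst (a + b) = mconst a + mconst b"
  by (simp add: mconst_def single_add)

lemma mconst_diff: "mconst (a - b) = mconst a - mconst b"
  by (simp add: mconst_def single_diff)

lemma mconst_mult: "mconst (a * b) = mconst a * mconst b"
  by (simp add: mconst_def mult_single)

lemma mconst_0: "mconst 0 = 0"
  by (simp add: mconst_def)

lemma mconst_1: "mconst 1 = 1"
  by (simp add: mconst_def)

lemma mconst_sum: "mconst (sum a X) = (\<Sum>x\<in>X. mconst (a x))"
  by (induction X rule: infinite_finite_induct) (simp_all add: mconst_add mconst_0)

lemma mconst_mult_single: "mconst a * Poly_Mapping.single \<beta> b = Poly_Mapping.single \<beta> (a * b)"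
  by (simp add: mconst_def mult_single)

lemma prod_mvar_power:
  fixes a :: "'v::finite \<Rightarrow>\<^sub>0 nat"
  shows "(\<Prod>i\<in>UNIV. mvar i ^ Poly_Mapping.lookup a i)
    = (Poly_Mapping.single a 1 :: ('v, 'a::comm_ring_1) mpol)"
proof -
  have pow: "mvar i ^ k = (Poly_Mapping.single (Poly_Mapping.single i k) 1 :: ('v, 'a) mpol)" for i k
    by (induction k) (simp_all add: mvar_def mult_single single_add[symmetric])
  have prod: "(\<Prod>i\<in>X. Poly_Mapping.single (e i) 1 :: ('v, 'a) mpol)
      = Poly_Mapping.single (\<Sum>i\<in>X. e i) 1" for X :: "'v set" and e :: "'v \<Rightarrow> 'v \<Rightarrow>\<^sub>0 nat"
    by (induction X rule: infinite_finite_induct) (simp_all add: mult_single)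
  have "(\<Sum>i\<in>UNIV. Poly_Mapping.single i (Poly_Mapping.lookup a i)) = a"
    by (rule poly_mapping_eqI) (simp add: lookup_sum lookup_single when_def)
  then show ?thesis
    by (simp only: pow prod)
qed

lemma mpol_times_mmon:
  fixes F :: "('v, 'a::comm_ring_1) mpol"
  shows "F * Poly_Mapping.single k 1
    = (\<Sum>\<beta>\<in>Poly_Mapping.keys F. Poly_Mapping.single (\<beta> + k) (Poly_Mapping.lookup F \<beta>))"
proof -
  have "F * Poly_Mapping.single k 1 = (\<Sum>\<beta>\<in>Poly_Mapping.keys F.
      Poly_Mapping.single \<beta> (Poly_Mapping.lookup F \<beta>)) * Poly_Mapping.single k 1"
    by (simp only: mpol_sum_singles[symmetric])
  then show ?thesis
    by (simp add: sum_distrib_right mult_single)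
qed

lemma lookup_times_mmon:
  fixes F :: "('v, 'a::comm_ring_1) mpol"
  shows "Poly_Mapping.lookup (F * Poly_Mapping.single k 1) (k + e) = Poly_Mapping.lookup F e"
  by (auto simp: mpol_times_mmon lookup_sum lookup_single when_def add.commute[of k]
      in_keys_iff)

lemma lookup_times_mmon_eq_0:
  fixes F :: "('v, 'a::comm_ring_1) mpol"
  assumes "\<And>e. m \<noteq> k + e"
  shows "Poly_Mapping.lookup (F * Poly_Mapping.single k 1) m = 0"
proof -
  have "\<beta> + k \<noteq> m" for \<beta>
    using assms[of \<beta>] by (simp add: add.commute)
  then show ?thesis
    by (simp add: mpol_times_mmon lookup_sum lookup_single when_def)
qed

section \<open>Evaluation homomorphisms and restriction to a set of variables\<close>

definition mpol_eval :: "('a::comm_ring_1 \<Rightarrow> 'b::comm_ring_1) \<Rightarrow> ('m::finite \<Rightarrow> 'b)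
    \<Rightarrow> ('m, 'a) mpol \<Rightarrow> 'b" where
  "mpol_eval \<phi> v F = (\<Sum>\<beta>\<in>Poly_Mapping.keys F.
     \<phi> (Poly_Mapping.lookup F \<beta>) * (\<Prod>j\<in>UNIV. v j ^ Poly_Mapping.lookup \<beta> j))"

text \<open>Under these assumptions \<open>mpol_eval\<close> is the ring homomorphism given by
  \<phi> on coefficients and v on variables. Two instances occur: \<open>mconst\<close> yields
  \<open>restrict_vars\<close>, and \<open>restrict_vars A\<close> yields the map that detects
  elements outside the conductor.\<close>

locale coeff_hom =
  fixes \<phi> :: "'a::comm_ring_1 \<Rightarrow> 'b::comm_ring_1"
  assumes hom_add: "\<phi> (a + b) = \<phi> a + \<phi> b"
    and hom_mult: "\<phi> (a * b) = \<phi> a * \<phi> b"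
    and hom_1: "\<phi> 1 = 1"
begin

lemma hom_0: "\<phi> 0 = 0"
  using hom_add[of 0 0] by simp

lemma hom_sum: "\<phi> (sum h X) = (\<Sum>x\<in>X. \<phi> (h x))"
  by (induction X rule: infinite_finite_induct) (simp_all add: hom_add hom_0)

lemma mpol_eval_superset:
  assumes "finite X" "Poly_Mapping.keys F \<subseteq> X"
  shows "mpol_eval \<phi> v F = (\<Sum>\<beta>\<in>X.
     \<phi> (Poly_Mapping.lookup F \<beta>) * (\<Prod>j\<in>UNIV. v j ^ Poly_Mapping.lookup \<beta> j))"
  unfolding mpol_eval_def using assms
  by (intro sum.mono_neutral_left) (auto simp: in_keys_iff hom_0)

lemma mpol_eval_single:
  "mpol_eval \<phi> v (Poly_Mapping.single \<beta> a)
    = \<phi> a * (\<Prod>j\<in>UNIV. v j ^ Poly_Mapping.lookup \<beta> j)"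
  by (subst mpol_eval_superset[where X = "{\<beta>}"]) simp_all

lemma mpol_eval_add: "mpol_eval \<phi> v (F + G) = mpol_eval \<phi> v F + mpol_eval \<phi> v G"
proof -
  let ?X = "Poly_Mapping.keys F \<union> Poly_Mapping.keys G"
  have "finite ?X" "Poly_Mapping.keys (F + G) \<subseteq> ?X"
    using keys_add[of F G] by auto
  then show ?thesis
    by (simp add: mpol_eval_superset[where X = ?X] lookup_add hom_add sum.distrib[symmetric]
        ring_distribs)
qed

lemma mpol_eval_0: "mpol_eval \<phi> v 0 = 0"
  by (simp add: mpol_eval_def)

lemma mpol_eval_sum: "mpol_eval \<phi> v (sum h X) = (\<Sum>x\<in>X. mpol_eval \<phi> v (h x))"
  by (induction X rule: infinite_finite_induct) (simp_all add: mpol_eval_add mpol_eval_0)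

lemma mpol_eval_mult: "mpol_eval \<phi> v (F * G) = mpol_eval \<phi> v F * mpol_eval \<phi> v G"
proof -
  have single: "mpol_eval \<phi> v (Poly_Mapping.single \<beta> a * Poly_Mapping.single \<gamma> b)
      = mpol_eval \<phi> v (Poly_Mapping.single \<beta> a) * mpol_eval \<phi> v (Poly_Mapping.single \<gamma> b)"
    for \<beta> \<gamma> a b
    by (simp only: mult_single mpol_eval_single lookup_add power_add prod.distrib hom_mult mult_ac)
  let ?F = "\<Sum>\<beta>\<in>Poly_Mapping.keys F. Poly_Mapping.single \<beta> (Poly_Mapping.lookup F \<beta>)"
  let ?G = "\<Sum>\<beta>\<in>Poly_Mapping.keys G. Poly_Mapping.single \<beta> (Poly_Mapping.lookup G \<beta>)"
  have "mpol_eval \<phi> v (?F * ?G) = mpol_eval \<phi> v ?F * mpol_eval \<phi> v ?G"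
    by (simp only: sum_product mpol_eval_sum single)
  then show ?thesis
    by (simp only: mpol_sum_singles[symmetric])
qed

lemma mpol_eval_mconst: "mpol_eval \<phi> v (mconst a) = \<phi> a"
  by (simp add: mconst_def mpol_eval_single)

lemma mpol_eval_mvar: "mpol_eval \<phi> v (mvar j) = v j"
proof -
  have "(\<Prod>i\<in>UNIV. v i ^ Poly_Mapping.lookup (Poly_Mapping.single j 1) i)
      = (\<Prod>i\<in>UNIV. if i = j then v i else 1)"
    by (intro prod.cong) (auto simp: lookup_single)
  then show ?thesis
    by (simp add: mvar_def mpol_eval_single hom_1)
qed

end

lemma coeff_hom_mconst: "coeff_hom mconst"
  by unfold_locales (simp_all add: mconst_add mconst_mult mconst_1)

text \<open>The quotient map by the variables outside A, realised as an endomorphism so that source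
  and target have the same type.\<close>

definition restrict_vars :: "'n::finite set \<Rightarrow> ('n, 'k::comm_ring_1) mpol \<Rightarrow> ('n, 'k) mpol" where
  "restrict_vars A = mpol_eval mconst (\<lambda>i. if i \<in> A then mvar i else 0)"

lemma coeff_hom_restrict_vars: "coeff_hom (restrict_vars A)"
  using coeff_hom.mpol_eval_mconst[OF coeff_hom_mconst, where a = 1]
  by unfold_locales
    (simp_all add: restrict_vars_def mconst_1 coeff_hom.mpol_eval_add[OF coeff_hom_mconst]
      coeff_hom.mpol_eval_mult[OF coeff_hom_mconst])

lemma restrict_vars_single:
  fixes k :: "'k::comm_ring_1"
  shows "restrict_vars A (Poly_Mapping.single b k)
    = (if Poly_Mapping.keys b \<subseteq> A then Poly_Mapping.single b k else 0)"
proof -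
  have eq: "restrict_vars A (Poly_Mapping.single b k) = mconst k *
      (\<Prod>i\<in>UNIV. (if i \<in> A then mvar i else 0) ^ Poly_Mapping.lookup b i)"
    unfolding restrict_vars_def by (rule coeff_hom.mpol_eval_single[OF coeff_hom_mconst])
  show ?thesis
  proof (cases "Poly_Mapping.keys b \<subseteq> A")
    case True
    have "(if i \<in> A then mvar i else 0) ^ Poly_Mapping.lookup b i
        = (mvar i ^ Poly_Mapping.lookup b i :: (_, 'k) mpol)" for i
    proof (cases "i \<in> A")
      case False
      with True have "Poly_Mapping.lookup b i = 0" by (meson in_keys_iff subsetD)
      then show ?thesis by simp
    qed simp
    with True eq show ?thesis
      by (simp add: prod_mvar_power mconst_mult_single)
  next
    case False
    then obtain i where i: "i \<in> Poly_Mapping.keys b" "i \<notin> A" by blast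
    then have "(if i \<in> A then mvar i else (0 :: (_, 'k) mpol)) ^ Poly_Mapping.lookup b i = 0"
      by (simp add: in_keys_iff zero_power)
    then have "(\<Prod>i\<in>UNIV. (if i \<in> A then mvar i else (0 :: (_, 'k) mpol))
        ^ Poly_Mapping.lookup b i) = 0"
      by (intro prod_zero bexI[of _ i]) auto
    with False eq show ?thesis by simp
  qed
qed

lemma lookup_restrict_vars:
  "Poly_Mapping.lookup (restrict_vars A F) e
    = (if Poly_Mapping.keys e \<subseteq> A then Poly_Mapping.lookup F e else 0)"
proof -
  have "restrict_vars A F = (\<Sum>\<beta>\<in>Poly_Mapping.keys F.
      restrict_vars A (Poly_Mapping.single \<beta> (Poly_Mapping.lookup F \<beta>)))"
    by (subst mpol_sum_singles[of F]) (rule coeff_hom.hom_sum[OF coeff_hom_restrict_vars])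
  then have "Poly_Mapping.lookup (restrict_vars A F) e = (\<Sum>\<beta>\<in>Poly_Mapping.keys F.
      Poly_Mapping.lookup (restrict_vars A (Poly_Mapping.single \<beta> (Poly_Mapping.lookup F \<beta>))) e)"
    by (simp add: lookup_sum)
  also have "\<dots> = (\<Sum>\<beta>\<in>Poly_Mapping.keys F.
      if \<beta> = e then (if Poly_Mapping.keys e \<subseteq> A then Poly_Mapping.lookup F e else 0) else 0)"
    by (intro sum.cong) (auto simp: restrict_vars_single lookup_single when_def)
  also have "\<dots> = (if e \<in> Poly_Mapping.keys F
      then (if Poly_Mapping.keys e \<subseteq> A then Poly_Mapping.lookup F e else 0) else 0)"
    by (rule sum.delta) simp
  finally show ?thesis
    by (cases "e \<in> Poly_Mapping.keys F") (simp_all add: not_in_keys_iff_lookup_eq_zero)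
qed

section \<open>Linear forms and the ideal of linear relations\<close>

definition linear_form :: "('m::finite \<Rightarrow> 'a::comm_ring_1) \<Rightarrow> ('m, 'a) mpol" where
  "linear_form a = (\<Sum>i\<in>UNIV. mconst (a i) * mvar i)"

lemma linear_form_scale: "mconst r * linear_form a = linear_form (\<lambda>i. r * a i)"
  by (simp only: linear_form_def sum_distrib_left mconst_mult mult.assoc)

lemma linear_form_diff: "linear_form a - linear_form b = linear_form (\<lambda>i. a i - b i)"
  by (simp only: linear_form_def sum_subtractf mconst_diff left_diff_distrib)

lemma linear_form_sum: "(\<Sum>x\<in>X. linear_form (a x)) = linear_form (\<lambda>i. \<Sum>x\<in>X. a x i)"
  by (simp only: linear_form_def mconst_sum sum_distrib_right) (rule sum.swap)

lemma linear_form_mvar: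
  "(mvar j :: ('m::finite, 'a::comm_ring_1) mpol) = linear_form (\<lambda>i. if i = j then 1 else 0)"
proof -
  have "(linear_form (\<lambda>i. if i = j then 1 else 0) :: ('m, 'a) mpol) = (\<Sum>i\<in>UNIV. if i = j then mvar i else 0)"
    unfolding linear_form_def by (intro sum.cong) (auto simp: mconst_1 mconst_0)
  also have "\<dots> = mvar j" by simp
  finally show ?thesis by simp
qed

lemma rees_hom_0: "rees_hom f 0 = 0"
  by (simp add: rees_hom_def)

lemma rees_hom_sum: "rees_hom f (sum h X) = (\<Sum>x\<in>X. rees_hom f (h x))"
  by (induction X rule: infinite_finite_induct) (simp_all add: rees_hom_add rees_hom_0)

lemma rees_hom_linear_form: "rees_hom f (linear_form a) = [:0, \<Sum>i\<in>UNIV. a i * f i:]"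
proof -
  have "(\<Sum>i\<in>X. [:0, g i:]) = [:0, \<Sum>i\<in>X. g i:]" for X :: "'b set" and g :: "'b \<Rightarrow> 'a::comm_ring_1"
    by (induction X rule: infinite_finite_induct) simp_all
  then show ?thesis
    by (simp add: linear_form_def rees_hom_sum rees_hom_mult rees_hom_mconst rees_hom_mvar
        mult.commute)
qed

text \<open>The interpretation is kept local: its simp rule \<open>scale_scale\<close> reads \<open>a * (b * x) = (a * b) * x\<close>
  and loops with \<open>algebra_simps\<close>.\<close>

context
begin

interpretation ring_self: module "(*) :: 'a::comm_ring_1 \<Rightarrow> 'a \<Rightarrow> 'a"
  by (rule module_ring_self)

lemma sym_ideal_linear_form: "(\<Sum>i\<in>UNIV. a i * f i) = 0 \<Longrightarrow> linear_form a \<in> sym_ideal f"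
  unfolding sym_ideal_def linear_form_def by (rule ring_self.span_base) auto

lemma sym_ideal_0: "0 \<in> sym_ideal f"
  unfolding sym_ideal_def by (rule ring_self.span_zero)

lemma sym_ideal_add: "F \<in> sym_ideal f \<Longrightarrow> G \<in> sym_ideal f \<Longrightarrow> F + G \<in> sym_ideal f"
  unfolding sym_ideal_def by (rule ring_self.span_add)

lemma sym_ideal_mult: "F \<in> sym_ideal f \<Longrightarrow> H * F \<in> sym_ideal f"
  unfolding sym_ideal_def by (rule ring_self.span_scale)

lemma sym_ideal_induct [consumes 1, case_names zero add]:
  assumes "F \<in> sym_ideal f" "P 0"
    and "\<And>H a G. (\<Sum>i\<in>UNIV. a i * f i) = 0 \<Longrightarrow> P G \<Longrightarrow> P (H * linear_form a + G)"
  shows "P F"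
  using assms(1) unfolding sym_ideal_def linear_form_def[symmetric]
  by (induction rule: ring_self.span_induct_alt) (auto intro: assms(2,3))

lemma ideal_gen_imageE:
  fixes f :: "'i \<Rightarrow> 'a::comm_ring_1"
  assumes "x \<in> ideal_gen (f ` I)" "finite I"
  obtains a where "x = (\<Sum>i\<in>I. a i * f i)"
proof -
  have "\<exists>a. x = (\<Sum>i\<in>I. a i * f i)"
    using assms(1)
  proof (induction rule: ring_self.span_induct_alt)
    case base
    show ?case by (rule exI[of _ "\<lambda>_. 0"]) simp
  next
    case (step r y z)
    then obtain a j where aj: "z = (\<Sum>i\<in>I. a i * f i)" "y = f j" "j \<in> I" by blast
    have "(\<Sum>i\<in>I. (if i = j then r else 0) * f i) = (\<Sum>i\<in>I. if i = j then r * f i else 0)"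
      by (intro sum.cong) auto
    then have "r * y + z = (\<Sum>i\<in>I. ((if i = j then r else 0) + a i) * f i)"
      using aj assms(2) by (simp add: distrib_right sum.distrib)
    then show ?case by (rule exI[of _ "\<lambda>i. (if i = j then r else 0) + a i"])
  qed
  with that show ?thesis by blast
qed

lemma ideal_gen_base: "x \<in> X \<Longrightarrow> x \<in> ideal_gen X"
  by (rule ring_self.span_base)

lemma ideal_gen_mult: "x \<in> ideal_gen X \<Longrightarrow> r * x \<in> ideal_gen X"
  by (rule ring_self.span_scale)

lemma ideal_gen_sum: "(\<And>i. i \<in> I \<Longrightarrow> h i \<in> ideal_gen X) \<Longrightarrow> sum h I \<in> ideal_gen X"
  by (rule ring_self.span_sum)

lemma sym_ideal_sum: "(\<And>i. i \<in> I \<Longrightarrow> h i \<in> sym_ideal f) \<Longrightarrow> sum h I \<in> sym_ideal f"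
  unfolding sym_ideal_def by (rule ring_self.span_sum)

end

lemma sym_ideal_le_rees_ideal: "sym_ideal f \<subseteq> rees_ideal f"
proof
  fix F assume "F \<in> sym_ideal f"
  then show "F \<in> rees_ideal f"
    by (induction rule: sym_ideal_induct)
      (simp_all add: rees_ideal_def rees_hom_0 rees_hom_add rees_hom_mult rees_hom_linear_form)
qed

section \<open>Squarefree monomials in the conductor\<close>

abbreviation mmon :: "('v \<Rightarrow>\<^sub>0 nat) \<Rightarrow> ('v, 'a::comm_ring_1) mpol" where
  "mmon a \<equiv> Poly_Mapping.single a 1"

definition squarefree_exp :: "'n set \<Rightarrow> 'n \<Rightarrow>\<^sub>0 nat" where
  "squarefree_exp S = (\<Sum>s\<in>S. unit_exp s)"

lemma lookup_squarefree_exp: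
  "Poly_Mapping.lookup (squarefree_exp (S :: 'n::finite set)) x = (if x \<in> S then 1 else 0)"
  by (simp add: squarefree_exp_def lookup_sum lookup_single when_def)

text \<open>The path x a b, y a b', x a' b'. With x = x_i, y = x_j and the generators of an
  exchange, each bracket is a linear relation.\<close>

lemma telescope2:
  fixes x y a b a' b' :: "'a::comm_ring_1"
  shows "x * (a * b - a' * b') = a * (x * b - y * b') + b' * (y * a - x * a')"
  by (simp add: algebra_simps)

text \<open>The path x a b, y k b, z k b', x a' b' through an intermediate generator k, again with
  one linear relation per step.\<close>

lemma telescope3:
  fixes x y z a b k a' b' :: "'a::comm_ring_1"
  shows "x * (a * b - a' * b') = b * (x * a - y * k) + k * (y * b - z * b') + b' * (z * k - x * a')"
  by (simp add: algebra_simps)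

text \<open>Encodes that the f_j generate the Veronese ideal: \<open>cf\<close> writes each monomial
  generator in the f_j, and \<open>bf\<close> writes each f_j in the monomials. These expressions
  are not unique; any choice serves.\<close>

locale veronese_generators =
  fixes f :: "'m::finite \<Rightarrow> ('n::finite, 'k::field) mpol"
    and d c :: nat
    and cf :: "('n \<Rightarrow>\<^sub>0 nat) \<Rightarrow> 'm \<Rightarrow> ('n, 'k) mpol"
    and bf :: "'m \<Rightarrow> ('n \<Rightarrow>\<^sub>0 nat) \<Rightarrow> ('n, 'k) mpol"
  assumes cf: "g \<in> bounded_exps d c \<Longrightarrow> (\<Sum>j\<in>UNIV. cf g j * f j) = mmon g"
    and bf: "f j = (\<Sum>g\<in>bounded_exps d c. bf j g * mmon g)"
begin

abbreviation B :: "('n \<Rightarrow>\<^sub>0 nat) set" where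
  "B \<equiv> bounded_exps d c"

definition gen :: "('n \<Rightarrow>\<^sub>0 nat) \<Rightarrow> ('m, ('n, 'k) mpol) mpol" where
  "gen g = linear_form (cf g)"

lemma rees_hom_gen: "g \<in> B \<Longrightarrow> rees_hom f (gen g) = [:0, mmon g:]"
  by (simp add: gen_def rees_hom_linear_form cf)

lemma linear_move:
  assumes "g \<in> B" "g' \<in> B" "b + g = b' + g'"
  shows "mconst (mmon b) * gen g - mconst (mmon b') * gen g' \<in> sym_ideal f"
proof -
  have "(\<Sum>i\<in>UNIV. (mmon b * cf g i - mmon b' * cf g' i) * f i)
      = mmon b * (\<Sum>i\<in>UNIV. cf g i * f i) - mmon b' * (\<Sum>i\<in>UNIV. cf g' i * f i)"
    by (simp only: sum_distrib_left sum_subtractf left_diff_distrib mult.assoc)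
  also have "\<dots> = 0"
    using assms by (simp add: cf mult_single)
  finally show ?thesis
    unfolding gen_def linear_form_scale linear_form_diff by (rule sym_ideal_linear_form)
qed

lemma unit_exp_move:
  assumes "g \<in> B" "g' \<in> B" "g + unit_exp i = g' + unit_exp j"
  shows "mconst (mmon (unit_exp i)) * gen g - mconst (mmon (unit_exp j)) * gen g' \<in> sym_ideal f"
  using assms by (intro linear_move) (simp_all add: add.commute)

text \<open>For s = i two linear moves suffice. Otherwise x_s enters g and releases x_i, giving k;
  x_i enters h and releases x_j; x_j enters k and releases x_s.\<close>

lemma quadratic_move_variable:
  assumes B: "g \<in> B" "g' \<in> B" "h \<in> B" "h' \<in> B"
    and gh: "g + unit_exp j = g' + unit_exp i" "h + unit_exp i = h' + unit_exp j"
    and s: "Poly_Mapping.lookup g s < c \<or> s = i"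
  shows "mconst (mmon (unit_exp s)) * (gen g * gen h - gen g' * gen h') \<in> sym_ideal f"
proof (cases "i = j")
  case True
  with gh show ?thesis by (simp add: sym_ideal_0)
next
  case ij: False
  let ?x = "\<lambda>i. mconst (mmon (unit_exp i)) :: ('m, ('n, 'k) mpol) mpol"
  have h: "?x i * gen h - ?x j * gen h' \<in> sym_ideal f"
    by (rule unit_exp_move[OF B(3,4) gh(2)])
  show ?thesis
  proof (cases "s = i")
    case True
    show ?thesis
      unfolding True telescope2[of "?x i" _ _ _ _ "?x j"]
      by (intro sym_ideal_add sym_ideal_mult h unit_exp_move[OF B(1,2) gh(1)])
  next
    case False
    have "Poly_Mapping.lookup g i + Poly_Mapping.lookup (unit_exp j) i
        = Poly_Mapping.lookup g' i + Poly_Mapping.lookup (unit_exp i) i"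
      by (simp only: gh(1) lookup_add[symmetric])
    then have "0 < Poly_Mapping.lookup g i"
      using ij by (simp add: lookup_unit_exp)
    then obtain k where k: "k \<in> B" "g + unit_exp s = k + unit_exp i"
      using s False by (elim bounded_exps_exchange[OF B(1)]) auto
    have "k + unit_exp j + unit_exp i = g' + unit_exp s + unit_exp i"
      using arg_cong[OF k(2), of "\<lambda>u. u + unit_exp j"] arg_cong[OF gh(1), of "\<lambda>u. u + unit_exp s"]
      by (simp only: ac_simps)
    then have k': "k + unit_exp j = g' + unit_exp s" by (rule add_right_imp_eq)
    show ?thesis
      unfolding telescope3[of "?x s" _ _ _ _ "?x i" "gen k" "?x j"]
      by (intro sym_ideal_add sym_ideal_mult h unit_exp_move[OF B(1) k]
          unit_exp_move[OF k(1) B(2) k'])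
  qed
qed

text \<open>An s in S that has room in g or h, or equals i or j, reduces this to
  \<open>quadratic_move_variable\<close>. If there is none, g and h are full on S and i, j lie
  outside S; for distinct i and j the assumption on d then forces a swap, whose difference is
  zero.\<close>

lemma quadratic_move:
  assumes S: "d \<le> card S * c + 1 \<or> c = 1 \<and> d + 1 = CARD('n)"
    and B: "g \<in> B" "g' \<in> B" "h \<in> B" "h' \<in> B"
    and gh: "g + unit_exp j = g' + unit_exp i" "h + unit_exp i = h' + unit_exp j"
  shows "mconst (mmon (squarefree_exp S)) * (gen g * gen h - gen g' * gen h') \<in> sym_ideal f"
proof (cases "\<exists>s\<in>S. Poly_Mapping.lookup g s < c \<or> s = i \<or> Poly_Mapping.lookup h s < c \<or> s = j")
  case True
  then obtain s where s: "s \<in> S"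
    "Poly_Mapping.lookup g s < c \<or> s = i \<or> Poly_Mapping.lookup h s < c \<or> s = j" by blast
  have x: "mconst (mmon (unit_exp s)) * (gen g * gen h - gen g' * gen h') \<in> sym_ideal f"
  proof (cases "Poly_Mapping.lookup g s < c \<or> s = i")
    case True
    show ?thesis by (rule quadratic_move_variable[OF B gh True])
  next
    case False
    with s have "Poly_Mapping.lookup h s < c \<or> s = j" by blast
    \<comment> \<open>Reading the exchange with g and h interchanged also interchanges i and
      j.\<close>
    then show ?thesis
      using quadratic_move_variable[OF B(3,4,1,2) gh(2,1)] by (simp only: mult.commute[of "gen g"]
        mult.commute[of "gen g'"])
  qed
  have "squarefree_exp S = squarefree_exp (S - {s}) + unit_exp s"
    unfolding squarefree_exp_def by (subst sum.remove[OF _ s(1)]) (simp_all add: add.commute)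
  then have "(mmon (squarefree_exp S) :: ('n, 'k) mpol)
      = mmon (squarefree_exp (S - {s})) * mmon (unit_exp s)"
    by (simp add: mult_single)
  then have "mconst (mmon (squarefree_exp S)) * (gen g * gen h - gen g' * gen h')
    = mconst (mmon (squarefree_exp (S - {s})))
      * (mconst (mmon (unit_exp s)) * (gen g * gen h - gen g' * gen h'))"
    by (simp only: mconst_mult mult.assoc)
  with x show ?thesis by (simp only: sym_ideal_mult)
next
  case False
  then have F: "\<And>s. s \<in> S \<Longrightarrow> c \<le> Poly_Mapping.lookup g s"
    "\<And>s. s \<in> S \<Longrightarrow> c \<le> Poly_Mapping.lookup h s" "i \<notin> S" "j \<notin> S" by (auto simp: not_less)
  show ?thesis
  proof (cases "i = j")
    case True
    with gh show ?thesis by (simp add: sym_ideal_0)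
  next
    case ij: False
    have lkg: "Poly_Mapping.lookup g x + (if j = x then 1 else 0)
        = Poly_Mapping.lookup g' x + (if i = x then 1 else 0)" for x
      using arg_cong[OF gh(1), of "\<lambda>p. Poly_Mapping.lookup p x"]
      by (simp add: lookup_add lookup_unit_exp)
    have lkh: "Poly_Mapping.lookup h x + (if i = x then 1 else 0)
        = Poly_Mapping.lookup h' x + (if j = x then 1 else 0)" for x
      using arg_cong[OF gh(2), of "\<lambda>p. Poly_Mapping.lookup p x"]
      by (simp add: lookup_add lookup_unit_exp)
    have "g + unit_exp j = h + unit_exp i"
      using S
    proof
      assume d: "d \<le> card S * c + 1"
      \<comment> \<open>The part of g and h that fills S. Its degree is at least d - 1, which leaves
        just one more variable: x_i in g and x_j in h.\<close>
      define u :: "'n \<Rightarrow>\<^sub>0 nat" where "u = (\<Sum>s\<in>S. Poly_Mapping.single s c)"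
      have lu: "Poly_Mapping.lookup u x = (if x \<in> S then c else 0)" for x
        by (simp add: u_def lookup_sum lookup_single when_def)
      have "exp_deg u = card S * c"
        by (simp add: lu sum.inter_restrict[symmetric])
      then have deg: "exp_deg (u + unit_exp x) = card S * c + 1" for x
        using exp_deg_unit_exp[of x] by (simp add: lookup_add sum.distrib)
      have key: "u + unit_exp x = a"
        if a: "a \<in> B" and "x \<notin> S" "0 < Poly_Mapping.lookup a x"
          "\<And>s. s \<in> S \<Longrightarrow> c \<le> Poly_Mapping.lookup a s" for x a
      proof -
        have le: "Poly_Mapping.lookup (u + unit_exp x) y \<le> Poly_Mapping.lookup a y" for y
          using that by (auto simp: lookup_add lu lookup_unit_exp)
        have "exp_deg (u + unit_exp x) \<le> exp_deg a"
          by (rule sum_mono) (rule le)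
        then have "exp_deg (u + unit_exp x) = exp_deg a"
          using bounded_expsD(1)[OF a] deg[of x] d by simp
        then show ?thesis using le by (rule exp_deg_eq_imp_eq)
      qed
      have "u + unit_exp i = g" "u + unit_exp j = h"
        using lkg[of i] lkh[of j] ij F B by (auto intro!: key)
      then show ?thesis by (auto simp: ac_simps)
    next
      \<comment> \<open>Here g + e_j has degree d + 1 = n and all exponents at most 1, so it is the
        vector of ones; likewise h + e_i.\<close>
      assume c: "c = 1 \<and> d + 1 = CARD('n)"
      have key: "Poly_Mapping.lookup (a + unit_exp x) y = 1"
        if "a \<in> B" "a' \<in> B" "\<And>z. Poly_Mapping.lookup a z + (if x = z then 1 else 0)
        = Poly_Mapping.lookup a' z + (if w = z then 1 else 0)" "w \<noteq> x" for a a' x w y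
      proof (rule ccontr)
        assume ne: "Poly_Mapping.lookup (a + unit_exp x) y \<noteq> 1"
        \<comment> \<open>At z = x the bound comes from a', as w differs from x.\<close>
        have le: "Poly_Mapping.lookup (a + unit_exp x) z \<le> 1" for z
          using bounded_expsD(2)[OF that(1), of z] bounded_expsD(2)[OF that(2), of z] that(3)[of z]
            that(4) c by (auto simp: lookup_add lookup_unit_exp split: if_splits)
        have "exp_deg (a + unit_exp x) < (\<Sum>z\<in>(UNIV::'n set). 1)"
        proof (rule sum_strict_mono_ex1)
          show "\<exists>z\<in>UNIV. Poly_Mapping.lookup (a + unit_exp x) z < 1"
            using le[of y] ne by (intro bexI[of _ y]) auto
        qed (use le in auto)
        moreover have "exp_deg (a + unit_exp x) = d + 1"
          using exp_deg_unit_exp[of x] bounded_expsD(1)[OF that(1)]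
          by (simp add: lookup_add sum.distrib)
        ultimately show False using c by simp
      qed
      show ?thesis
        by (rule poly_mapping_eqI)
          (use key[OF B(1,2) lkg ij] key[OF B(3,4) lkh ij[symmetric]] in simp)
    qed
    with gh have "g' = h" "h' = g" by (metis add_right_imp_eq)+
    then show ?thesis by (simp add: mult.commute sym_ideal_0)
  qed
qed

definition state_mon :: "('n \<Rightarrow>\<^sub>0 nat) \<Rightarrow> ('n \<Rightarrow>\<^sub>0 nat) multiset \<Rightarrow> ('m, ('n, 'k) mpol) mpol" where
  "state_mon b M = mconst (mmon b) * prod_mset (image_mset gen M)"

lemma state_mon_add:
  "state_mon (v + b) (N + M) = state_mon v N * state_mon b M"
proof -
  have "(mmon (v + b) :: ('n, 'k) mpol) = mmon v * mmon b"
    by (simp add: mult_single)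
  then show ?thesis
    by (simp only: state_mon_def mconst_mult image_mset_union prod_mset_Un mult_ac)
qed

text \<open>Only quadratic steps use the factor x_S. One factor serves paths of any length, since it
  multiplies the difference of each step and these differences add up.\<close>

lemma conn_imp_sym_ideal:
  assumes S: "d \<le> card S * c + 1 \<or> c = 1 \<and> d + 1 = CARD('n)"
    and "conn d c b M b' M'"
  shows "mconst (mmon (squarefree_exp S)) * (state_mon b M - state_mon b' M') \<in> sym_ideal f"
  using assms(2)
proof induction
  case (refl b M)
  show ?case by (simp add: sym_ideal_0)
next
  case (linear g g' b b')
  then show ?case
    by (auto intro!: sym_ideal_mult linear_move simp: state_mon_def)
next
  case (quadratic g g' h h' j i)
  have "state_mon 0 {#g, h#} = gen g * gen h" for g h
    by (simp add: state_mon_def mconst_1)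
  then show ?case using quadratic_move[OF S quadratic(1-6)] by (simp only:)
next
  case (trans b M b' M' b'' M'')
  from sym_ideal_add[OF trans.IH] show ?case
    by (simp only: distrib_left[symmetric] diff_add_cancel add_diff_eq)
next
  case (cong b M b' M' N v)
  from sym_ideal_mult[OF cong.IH, of "state_mon v N"] show ?case
    by (simp only: state_mon_add right_diff_distrib[symmetric] mult.left_commute[of "mconst _"])
qed

end

section \<open>A K-linear section over the Rees algebra\<close>

definition coeff2 :: "('n, 'k::comm_ring_1) mpol poly \<Rightarrow> ('n \<Rightarrow>\<^sub>0 nat) \<times> nat \<Rightarrow> 'k" where
  "coeff2 P z = Poly_Mapping.lookup (coeff P (snd z)) (fst z)"

lemma finite_coeff2: "finite {z. coeff2 P z \<noteq> 0}"
proof (rule finite_subset)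
  show "{z. coeff2 P z \<noteq> 0} \<subseteq> (\<Union>k\<le>degree P. Poly_Mapping.keys (coeff P k) \<times> {k})"
  proof
    fix z assume z: "z \<in> {z. coeff2 P z \<noteq> 0}"
    then have "coeff P (snd z) \<noteq> 0" by (auto simp: coeff2_def)
    then have "snd z \<le> degree P" by (rule le_degree)
    with z show "z \<in> (\<Union>k\<le>degree P. Poly_Mapping.keys (coeff P k) \<times> {k})"
      by (cases z) (auto simp: coeff2_def in_keys_iff)
  qed
qed simp

lemma coeff2_0: "coeff2 0 z = 0"
  by (simp add: coeff2_def)

lemma coeff2_add: "coeff2 (P + Q) z = coeff2 P z + coeff2 Q z"
  by (simp add: coeff2_def lookup_add)

text \<open>The \<open>K\<close>-linear map that sends \<open>x^a t^i\<close> to \<open>\<rho> (a, i)\<close>.\<close>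

definition linear_ext :: "(('n \<Rightarrow>\<^sub>0 nat) \<times> nat \<Rightarrow> ('m, ('n, 'k::comm_ring_1) mpol) mpol)
    \<Rightarrow> ('n, 'k) mpol poly \<Rightarrow> ('m, ('n, 'k) mpol) mpol" where
  "linear_ext \<rho> P = (\<Sum>z | coeff2 P z \<noteq> 0. mconst (mconst (coeff2 P z)) * \<rho> z)"

lemma linear_ext_superset:
  assumes "finite X" "{z. coeff2 P z \<noteq> 0} \<subseteq> X"
  shows "linear_ext \<rho> P = (\<Sum>z\<in>X. mconst (mconst (coeff2 P z)) * \<rho> z)"
  unfolding linear_ext_def using assms
  by (intro sum.mono_neutral_left) (auto simp: mconst_0)

lemma linear_ext_add: "linear_ext \<rho> (P + Q) = linear_ext \<rho> P + linear_ext \<rho> Q"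
proof -
  let ?X = "{z. coeff2 P z \<noteq> 0} \<union> {z. coeff2 Q z \<noteq> 0}"
  have X: "finite ?X" "{z. coeff2 (P + Q) z \<noteq> 0} \<subseteq> ?X"
    by (auto simp: finite_coeff2 coeff2_add)
  show ?thesis
    by (simp add: linear_ext_superset[OF X] linear_ext_superset[OF X(1), of P]
        linear_ext_superset[OF X(1), of Q] coeff2_add mconst_add distrib_right sum.distrib)
qed

lemma linear_ext_0: "linear_ext \<rho> 0 = 0"
  by (simp add: linear_ext_def coeff2_0)

lemma linear_ext_monom:
  "linear_ext \<rho> (monom (Poly_Mapping.single a k) i) = mconst (mconst k) * \<rho> (a, i)"
proof -
  have co: "coeff2 (monom (Poly_Mapping.single a k) i) z = (if z = (a, i) then k else 0)" for z
    by (cases z) (auto simp: coeff2_def lookup_single when_def)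
  have "linear_ext \<rho> (monom (Poly_Mapping.single a k) i)
      = (\<Sum>z\<in>{(a, i)}. mconst (mconst (coeff2 (monom (Poly_Mapping.single a k) i) z)) * \<rho> z)"
    by (rule linear_ext_superset) (auto simp: co)
  then show ?thesis by (simp add: co)
qed

context veronese_generators
begin

text \<open>The K-span of L and the state products, which turns out to be all of T. The inductive
  form allows the section to be compared with an arbitrary F case by case.\<close>

inductive spanned :: "('m, ('n, 'k) mpol) mpol \<Rightarrow> bool" where
  sym: "F \<in> sym_ideal f \<Longrightarrow> spanned F"
| mon: "set_mset M \<subseteq> B \<Longrightarrow> spanned (mconst (mconst k) * state_mon b M)"
| add: "spanned F \<Longrightarrow> spanned G \<Longrightarrow> spanned (F + G)"

lemma spanned_sum: "(\<And>x. x \<in> X \<Longrightarrow> spanned (h x)) \<Longrightarrow> spanned (sum h X)"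
  by (induction X rule: infinite_finite_induct)
    (auto intro: spanned.add spanned.sym sym_ideal_0)

lemma state_mon_single:
  "mconst (Poly_Mapping.single \<beta> k) * state_mon b M = mconst (mconst k) * state_mon (\<beta> + b) M"
proof -
  have "mconst k * mmon (\<beta> + b) = Poly_Mapping.single \<beta> k * mmon b"
    by (simp add: mconst_def mult_single)
  then show ?thesis
    by (simp only: state_mon_def mult.assoc[symmetric] mconst_mult[symmetric])
qed

lemma spanned_mconst: "spanned F \<Longrightarrow> spanned (mconst a * F)"
proof (induction rule: spanned.induct)
  case (sym F)
  then show ?case by (intro spanned.sym sym_ideal_mult)
next
  case (mon M k b)
  have step: "mconst (Poly_Mapping.single \<beta> k') * (mconst (mconst k) * state_mon b M)
      = mconst (mconst (k' * k)) * state_mon (\<beta> + b) M" for \<beta> k'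
    unfolding mult.left_commute[of "mconst (Poly_Mapping.single \<beta> k')"] state_mon_single
      mconst_mult by (simp only: mult_ac)
  have "mconst a * (mconst (mconst k) * state_mon b M)
      = mconst (\<Sum>\<beta>\<in>Poly_Mapping.keys a. Poly_Mapping.single \<beta> (Poly_Mapping.lookup a \<beta>))
        * (mconst (mconst k) * state_mon b M)"
    by (simp only: mpol_sum_singles[symmetric])
  also have "\<dots> = (\<Sum>\<beta>\<in>Poly_Mapping.keys a.
      mconst (mconst (Poly_Mapping.lookup a \<beta> * k)) * state_mon (\<beta> + b) M)"
    by (simp only: mconst_sum sum_distrib_right step)
  finally show ?case using mon by (simp only:) (intro spanned_sum spanned.mon)
next
  case (add F G)
  then show ?case by (simp only: distrib_left) (rule spanned.add)
qed

lemma spanned_gen: "spanned F \<Longrightarrow> g \<in> B \<Longrightarrow> spanned (gen g * F)"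
proof (induction rule: spanned.induct)
  case (sym F)
  then show ?case by (intro spanned.sym sym_ideal_mult)
next
  case (mon M k b)
  have "gen g * (mconst (mconst k) * state_mon b M)
      = mconst (mconst k) * state_mon b (add_mset g M)"
    by (simp only: state_mon_def image_mset_add_mset prod_mset.add_mset mult_ac)
  moreover have "set_mset (add_mset g M) \<subseteq> B" using mon by auto
  ultimately show ?case by (simp only:) (rule spanned.mon)
next
  case (add F G)
  from spanned.add[OF add.IH(1)[OF add.prems] add.IH(2)[OF add.prems]]
  show ?case by (simp only: distrib_left)
qed

text \<open>Both terms have image f_j t: expanding f_j by \<open>bf\<close> and then each monomial
  by \<open>cf\<close> returns f_j, so the difference is a linear relation. This reduces arbitrary
  generators to monomial ones.\<close>

lemma mvar_minus_gens:
  "mvar j - (\<Sum>g\<in>B. mconst (bf j g) * gen g) \<in> sym_ideal f"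
proof -
  have "(\<Sum>i\<in>UNIV. (\<Sum>g\<in>B. bf j g * cf g i) * f i) = (\<Sum>g\<in>B. \<Sum>i\<in>UNIV. bf j g * (cf g i * f i))"
    by (simp only: sum_distrib_right mult.assoc) (rule sum.swap)
  also have "\<dots> = f j"
    by (simp add: sum_distrib_left[symmetric] cf bf[of j, symmetric])
  finally have swap: "(\<Sum>i\<in>UNIV. (\<Sum>g\<in>B. bf j g * cf g i) * f i) = f j" .
  have "(\<Sum>i\<in>UNIV. (if i = j then 1 else 0) * f i) = (\<Sum>i\<in>UNIV. if i = j then f i else 0)"
    by (intro sum.cong) auto
  then have one: "(\<Sum>i\<in>UNIV. (if i = j then 1 else 0) * f i) = f j"
    by simp
  show ?thesis
    unfolding gen_def linear_form_scale linear_form_sum linear_form_mvar linear_form_diff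
    by (rule sym_ideal_linear_form) (simp only: left_diff_distrib sum_subtractf swap one diff_self)
qed

lemma spanned_mvar:
  assumes "spanned F"
  shows "spanned (mvar j * F)"
proof -
  let ?G = "\<Sum>g\<in>B. mconst (bf j g) * gen g"
  have "mvar j * F = F * (mvar j - ?G) + (\<Sum>g\<in>B. mconst (bf j g) * (gen g * F))"
    by (simp only: right_diff_distrib sum_distrib_left sum_distrib_right mult_ac diff_add_cancel)
  also have "spanned \<dots>"
    by (intro spanned.add spanned.sym sym_ideal_mult mvar_minus_gens spanned_sum spanned_mconst
        spanned_gen assms)
  finally show ?thesis .
qed

text \<open>1 is the state product of the empty multiset, and the span is closed under
  multiplication by constants and by the variables y_j.\<close>

lemma spanned_all: "spanned F"
proof -
  have pow: "spanned (mvar j ^ k * G)" if "spanned G" for j k G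
    using that by (induction k) (simp_all add: mult.assoc spanned_mvar)
  have one: "spanned 1"
    using spanned.mon[of "{#}" 1 0] by (simp add: state_mon_def mconst_1)
  have prod: "spanned (\<Prod>j\<in>X. mvar j ^ k j)" for X :: "'m set" and k
    by (induction X rule: infinite_finite_induct) (simp_all add: one pow)
  have "spanned (mconst (Poly_Mapping.lookup F \<beta>) * (\<Prod>j\<in>UNIV. mvar j ^ Poly_Mapping.lookup \<beta> j))"
    for \<beta>
    by (intro spanned_mconst prod)
  then have "spanned (Poly_Mapping.single \<beta> (Poly_Mapping.lookup F \<beta>))" for \<beta>
    by (simp add: prod_mvar_power mconst_mult_single)
  then have "spanned (\<Sum>\<beta>\<in>Poly_Mapping.keys F. Poly_Mapping.single \<beta> (Poly_Mapping.lookup F \<beta>))"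
    by (intro spanned_sum)
  then show ?thesis by (simp only: mpol_sum_singles[symmetric])
qed

lemma rees_hom_state_mon:
  assumes "set_mset M \<subseteq> B"
  shows "rees_hom f (mconst (mconst k) * state_mon b M)
    = monom (Poly_Mapping.single (b + \<Sum>\<^sub># M) k) (size M)"
proof -
  have "rees_hom f (prod_mset (image_mset gen M)) = monom (mmon (\<Sum>\<^sub># M)) (size M)"
    using assms
  proof (induction M)
    case empty
    show ?case using rees_hom_mconst[of f 1] by (simp add: mconst_1 one_pCons)
  next
    case (add g M)
    have "([:0, mmon g:] :: ('n, 'k) mpol poly) = monom (mmon g) (Suc 0)"
      by (simp add: monom_Suc monom_0)
    then have "[:0, mmon g:] * monom (mmon (\<Sum>\<^sub># M)) (size M)
        = (monom (mmon (g + \<Sum>\<^sub># M)) (Suc (size M)) :: ('n, 'k) mpol poly)"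
      by (simp only: mult_monom) (simp add: mult_single)
    with add show ?case
      by (simp add: rees_hom_mult rees_hom_gen del: mult_pCons_left)
  qed
  then show ?thesis
    by (simp add: state_mon_def rees_hom_mult rees_hom_mconst mconst_mult_single smult_monom
        mult_single)
qed

text \<open>Choosing one state for every image monomial gives a \<open>K\<close>-linear section of the map to the Rees
  algebra, up to multiplication by \<open>x\<^sub>S\<close> and linear relations.\<close>

lemma squarefree_mult_rees_ideal:
  assumes S: "d \<le> card S * c + 1 \<or> c = 1 \<and> d + 1 = CARD('n)"
    and F: "F \<in> rees_ideal f"
  shows "mconst (mmon (squarefree_exp S)) * F \<in> sym_ideal f"
proof -
  let ?X = "mconst (mmon (squarefree_exp S)) :: ('m, ('n, 'k) mpol) mpol"
  \<comment> \<open>One representative G for each image monomial; if no state has this image, any G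
    will do.\<close>
  have "\<exists>G. \<forall>b M. set_mset M \<subseteq> B \<and> b + \<Sum>\<^sub># M = fst z \<and> size M = snd z
      \<longrightarrow> ?X * (state_mon b M - G) \<in> sym_ideal f" for z
  proof (cases "\<exists>b M. set_mset M \<subseteq> B \<and> b + \<Sum>\<^sub># M = fst z \<and> size M = snd z")
    case True
    then obtain b' M' where z: "set_mset M' \<subseteq> B" "b' + \<Sum>\<^sub># M' = fst z" "size M' = snd z" by blast
    have "?X * (state_mon b M - state_mon b' M') \<in> sym_ideal f"
      if "set_mset M \<subseteq> B" "b + \<Sum>\<^sub># M = fst z" "size M = snd z" for b M
      using that z by (intro conn_imp_sym_ideal[OF S] conn_of_same_image) simp_all
    then show ?thesis by blast
  qed blast
  then have "\<exists>\<rho>. \<forall>z b M. set_mset M \<subseteq> B \<and> b + \<Sum>\<^sub># M = fst z \<and> size M = snd z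
      \<longrightarrow> ?X * (state_mon b M - \<rho> z) \<in> sym_ideal f"
    by (intro choice allI)
  then obtain \<rho> where *: "\<forall>z b M. set_mset M \<subseteq> B \<and> b + \<Sum>\<^sub># M = fst z \<and> size M = snd z
      \<longrightarrow> ?X * (state_mon b M - \<rho> z) \<in> sym_ideal f" ..
  have \<rho>: "?X * (state_mon b M - \<rho> (b + \<Sum>\<^sub># M, size M)) \<in> sym_ideal f"
    if "set_mset M \<subseteq> B" for b M
    by (rule *[rule_format]) (simp add: that)
  \<comment> \<open>The claim is additive in F, so the spanning elements suffice. For F in J the
    section term vanishes.\<close>
  have "?X * (F - linear_ext \<rho> (rees_hom f F)) \<in> sym_ideal f"
    using spanned_all[of F]
  proof induction
    case (sym F)
    then have "rees_hom f F = 0"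
      using sym_ideal_le_rees_ideal[of f] by (auto simp: rees_ideal_def)
    with sym show ?case by (simp add: linear_ext_0 sym_ideal_mult)
  next
    case (mon M k b)
    have "?X * (mconst (mconst k) * state_mon b M - mconst (mconst k) * \<rho> (b + \<Sum>\<^sub># M, size M))
        = mconst (mconst k) * (?X * (state_mon b M - \<rho> (b + \<Sum>\<^sub># M, size M)))"
      by (simp only: right_diff_distrib mult.left_commute)
    with mon \<rho>[of M b] show ?case
      by (simp only: rees_hom_state_mon linear_ext_monom sym_ideal_mult)
  next
    case (add F G)
    from sym_ideal_add[OF add.IH] show ?case
      by (simp only: rees_hom_add linear_ext_add distrib_left[symmetric] add_diff_add)
  qed
  with F show ?thesis by (simp add: rees_ideal_def linear_ext_0)
qed

end

section \<open>Elements outside the conductor\<close>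

context veronese_generators
begin

text \<open>Setting the variables outside \<open>A\<close> to zero kills all coefficients at \<open>g\<close> of syzygies of the
  monomials, because \<open>g\<close> is maximal on \<open>A\<close>.\<close>

lemma restrict_vars_syzygy:
  assumes rel: "(\<Sum>k\<in>B. b k * mmon k) = (0 :: ('n, 'k) mpol)"
    and g: "g \<in> B" and A: "\<And>s. s \<in> A \<Longrightarrow> Poly_Mapping.lookup g s = c"
  shows "restrict_vars A (b g) = 0"
proof (rule poly_mapping_eqI)
  fix e
  have "Poly_Mapping.lookup (b g) e = 0" if e: "Poly_Mapping.keys e \<subseteq> A"
  proof -
    \<comment> \<open>If x^k divides x^(g + e), then k \<le> g outside A because e lives on A, and
      on A because g attains the bound c there; equal degrees give k = g.\<close>
    have other: "Poly_Mapping.lookup (b k * mmon k) (g + e) = 0" if k: "k \<in> B" "k \<noteq> g" for k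
    proof (rule lookup_times_mmon_eq_0)
      fix e'
      show "g + e \<noteq> k + e'"
      proof
        assume eq: "g + e = k + e'"
        have "k = g"
        proof (rule exp_deg_eq_imp_eq)
          show "exp_deg k = exp_deg g" using k g by (simp add: bounded_expsD(1))
          fix x
          show "Poly_Mapping.lookup k x \<le> Poly_Mapping.lookup g x"
          proof (cases "x \<in> A")
            case True
            then show ?thesis using A bounded_expsD(2)[OF k(1)] by simp
          next
            case False
            with e have "Poly_Mapping.lookup e x = 0" by (meson in_keys_iff subsetD)
            then show ?thesis
              using arg_cong[OF eq, of "\<lambda>p. Poly_Mapping.lookup p x"] by (simp add: lookup_add)
          qed
        qed
        with k show False by simp
      qed
    qed
    have "0 = Poly_Mapping.lookup (\<Sum>k\<in>B. b k * mmon k) (g + e)"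
      by (simp only: rel lookup_zero)
    also have "\<dots> = Poly_Mapping.lookup (b g * mmon g) (g + e)"
      unfolding lookup_sum
      by (subst sum.remove[OF finite_bounded_exps g]) (simp add: other)
    finally show ?thesis
      by (simp only: lookup_times_mmon)
  qed
  then show "Poly_Mapping.lookup (restrict_vars A (b g)) e = Poly_Mapping.lookup 0 e"
    by (simp add: lookup_restrict_vars)
qed

text \<open>Two expansions of the same element in the bounded monomials differ by a syzygy, so after
  restriction they have the same coefficient at g.\<close>

lemma restrict_vars_coefficient:
  assumes rel: "(\<Sum>j\<in>UNIV. a j * f j) = (\<Sum>k\<in>B. b k * mmon k)"
    and g: "g \<in> B" and A: "\<And>s. s \<in> A \<Longrightarrow> Poly_Mapping.lookup g s = c"
  shows "restrict_vars A (\<Sum>j\<in>UNIV. a j * bf j g) = restrict_vars A (b g)"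
proof -
  interpret coeff_hom "restrict_vars A" by (rule coeff_hom_restrict_vars)
  have "(\<Sum>j\<in>UNIV. a j * f j) = (\<Sum>j\<in>UNIV. \<Sum>k\<in>B. a j * (bf j k * mmon k))"
    by (subst bf) (simp only: sum_distrib_left)
  also have "\<dots> = (\<Sum>k\<in>B. (\<Sum>j\<in>UNIV. a j * bf j k) * mmon k)"
    by (subst sum.swap) (simp only: sum_distrib_right mult.assoc)
  finally have "(\<Sum>k\<in>B. ((\<Sum>j\<in>UNIV. a j * bf j k) - b k) * mmon k) = 0"
    using rel by (simp only: left_diff_distrib sum_subtractf diff_self)
  from restrict_vars_syzygy[OF this g A]
  have "restrict_vars A ((\<Sum>j\<in>UNIV. a j * bf j g) - b g) = 0" .
  then show ?thesis
    using hom_add[of "(\<Sum>j\<in>UNIV. a j * bf j g) - b g" "b g"] by (simp only: diff_add_cancel add_0_left)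
qed

lemma conductor_restrict_vars:
  assumes r: "r \<in> conductor f"
    and B: "g \<in> B" "h \<in> B" "g' \<in> B" "h' \<in> B" and sum: "g + h = g' + h'"
    and ne: "g' \<noteq> g" "g' \<noteq> h"
    and A: "\<And>s. s \<in> A \<Longrightarrow> Poly_Mapping.lookup g s = c" "\<And>s. s \<in> A \<Longrightarrow> Poly_Mapping.lookup h s = c"
  shows "restrict_vars A r = 0"
proof -
  let ?q = "restrict_vars A :: ('n, 'k) mpol \<Rightarrow> ('n, 'k) mpol"
  interpret coeff_hom ?q by (rule coeff_hom_restrict_vars)
  \<comment> \<open>Each y_j goes to the sum of the restricted coefficients of f_j at x^g and x^h.
    This makes L vanish, sends \<open>gen g\<close> and \<open>gen h\<close> to 1 and the other
    \<open>gen l\<close> to 0.\<close>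
  let ?\<theta> = "mpol_eval ?q (\<lambda>j. \<Sum>k\<in>{g, h}. ?q (bf j k))"
  have kB: "k \<in> B" and kA: "\<And>s. s \<in> A \<Longrightarrow> Poly_Mapping.lookup k s = c" if "k \<in> {g, h}" for k
    using that B A by auto
  have linear: "?\<theta> (linear_form a) = (\<Sum>k\<in>{g, h}. ?q (\<Sum>j\<in>UNIV. a j * bf j k))" for a
  proof -
    have "?\<theta> (linear_form a) = (\<Sum>j\<in>UNIV. \<Sum>k\<in>{g, h}. ?q (a j) * ?q (bf j k))"
      by (simp only: linear_form_def mpol_eval_sum mpol_eval_mult mpol_eval_mconst mpol_eval_mvar
          sum_distrib_left)
    also have "\<dots> = (\<Sum>k\<in>{g, h}. ?q (\<Sum>j\<in>UNIV. a j * bf j k))"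
      by (subst sum.swap) (simp only: hom_sum hom_mult)
    finally show ?thesis .
  qed
  have zero: "?\<theta> F = 0" if "F \<in> sym_ideal f" for F
    using that
  proof (induction rule: sym_ideal_induct)
    case zero
    show ?case by (rule mpol_eval_0)
  next
    case (add H a G)
    have "?q (\<Sum>j\<in>UNIV. a j * bf j k) = ?q 0" if "k \<in> {g, h}" for k
      using add(1) kB[OF that] kA[OF that] by (intro restrict_vars_coefficient) simp_all
    then have "?\<theta> (linear_form a) = 0"
      by (simp only: linear hom_0 sum.neutral_const cong: sum.cong)
    with add(2) show ?case
      by (simp only: mpol_eval_add mpol_eval_mult mult_zero_right add_0)
  qed
  have gen: "?\<theta> (gen l) = (if l \<in> {g, h} then 1 else 0)" if l: "l \<in> B" for l
  proof -
    have "(\<Sum>k\<in>B. (if k = l then 1 else 0) * mmon k) = (\<Sum>k\<in>B. if k = l then mmon l else 0 :: ('n, 'k) mpol)"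
      by (intro sum.cong) auto
    also have "\<dots> = mmon l"
      using l by (simp add: finite_bounded_exps)
    finally have "(\<Sum>j\<in>UNIV. cf l j * f j) = (\<Sum>k\<in>B. (if k = l then 1 else 0) * mmon k)"
      using cf[OF l] by simp
    then have "?q (\<Sum>j\<in>UNIV. cf l j * bf j k) = ?q (if k = l then 1 else 0)" if "k \<in> {g, h}" for k
      using kB[OF that] kA[OF that] by (rule restrict_vars_coefficient)
    then have "?\<theta> (gen l) = (\<Sum>k\<in>{g, h}. if k = l then 1 else 0)"
      unfolding gen_def linear by (intro sum.cong) (auto simp: hom_1 hom_0)
    also have "\<dots> = (if l \<in> {g, h} then 1 else 0)"
      by (rule sum.delta) simp
    finally show ?thesis .
  qed
  have "rees_hom f (gen k * gen l) = [:0, 0, mmon (k + l):]" if "k \<in> B" "l \<in> B" for k l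
    using that by (simp add: rees_hom_mult rees_hom_gen mult_single add.commute)
  then have "rees_hom f (gen g * gen h) = rees_hom f (gen g' * gen h')"
    using B sum by simp
  moreover have "rees_hom f (gen g * gen h)
      = rees_hom f (gen g * gen h - gen g' * gen h') + rees_hom f (gen g' * gen h')"
    by (simp only: rees_hom_add[symmetric] diff_add_cancel)
  ultimately have "gen g * gen h - gen g' * gen h' \<in> rees_ideal f"
    by (simp add: rees_ideal_def)
  with r have "mconst r * (gen g * gen h - gen g' * gen h') \<in> sym_ideal f"
    by (auto simp: conductor_def)
  then have "0 = ?\<theta> (mconst r * (gen g * gen h - gen g' * gen h'))"
    by (simp only: zero)
  \<comment> \<open>The added term is zero since \<open>gen g'\<close> goes to 0. It cancels the
    second product, so that additivity suffices and only the restriction of r remains.\<close>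
  also have "\<dots> = ?\<theta> (mconst r * (gen g * gen h - gen g' * gen h')) + ?q r * ?\<theta> (gen g') * ?\<theta> (gen h')"
    using ne by (simp add: gen B)
  also have "\<dots> = ?\<theta> (mconst r * (gen g * gen h - gen g' * gen h') + mconst r * gen g' * gen h')"
    by (simp only: mpol_eval_add mpol_eval_mult mpol_eval_mconst)
  also have "mconst r * (gen g * gen h - gen g' * gen h') + mconst r * gen g' * gen h'
      = mconst r * gen g * gen h"
    by (simp only: right_diff_distrib mult.assoc diff_add_cancel)
  also have "?\<theta> (mconst r * gen g * gen h) = ?q r"
    using B by (simp add: mpol_eval_mult mpol_eval_mconst gen)
  finally show ?thesis by simp
qed

end

section \<open>Pairs of monomials that are full on A and have a second factorization\<close>

lemma ex_between_with_sum:
  fixes lo hi :: "'n::finite \<Rightarrow> nat"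
  assumes le: "\<And>i. lo i \<le> hi i" and "sum lo UNIV \<le> D" "D \<le> sum hi UNIV"
  shows "\<exists>m. (\<forall>i. lo i \<le> m i \<and> m i \<le> hi i) \<and> sum m UNIV = D"
  using assms(2,3)
proof (induction D rule: dec_induct)
  case base
  show ?case using le by (intro exI[of _ lo]) simp
next
  case (step D)
  then obtain m where m: "\<And>i. lo i \<le> m i \<and> m i \<le> hi i" "sum m UNIV = D" by auto
  have "\<exists>i. m i < hi i"
  proof (rule ccontr)
    assume "\<not> ?thesis"
    then have "sum hi UNIV \<le> sum m UNIV" by (intro sum_mono) (simp add: not_less)
    with m step show False by simp
  qed
  then obtain i where i: "m i < hi i" by blast
  have "sum (m(i := Suc (m i))) UNIV = Suc D"
    using m(2) by (simp add: sum.remove[of UNIV i])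
  moreover have "lo x \<le> (m(i := Suc (m i))) x \<and> (m(i := Suc (m i))) x \<le> hi x" for x
    using m(1)[of x] i by auto
  ultimately show ?case by blast
qed

text \<open>The lower bounds are c on A and 0 elsewhere, the upper bounds w on W and c elsewhere;
  the two inequalities for D compare it with the totals of these bounds.\<close>

lemma ex_bounded_exp:
  fixes A W :: "'n::finite set"
  assumes "A \<inter> W = {}" "card A * c \<le> D" "D \<le> (CARD('n) - card W) * c + card W * w" "w \<le> c"
  obtains m where "exp_deg m = D" "\<And>x. Poly_Mapping.lookup m x \<le> c"
    "\<And>x. x \<in> A \<Longrightarrow> Poly_Mapping.lookup m x = c" "\<And>x. x \<in> W \<Longrightarrow> Poly_Mapping.lookup m x \<le> w"
proof -
  let ?lo = "\<lambda>x. if x \<in> A then c else 0" and ?hi = "\<lambda>x. if x \<in> W then w else c"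
  have lo: "sum ?lo UNIV = card A * c"
    by (simp add: sum.inter_restrict[symmetric])
  have hi: "sum ?hi UNIV = (CARD('n) - card W) * c + card W * w"
    by (simp add: sum.If_cases card_Diff_subset Compl_eq_Diff_UNIV)
  have "\<exists>m. (\<forall>i. ?lo i \<le> m i \<and> m i \<le> ?hi i) \<and> sum m UNIV = D"
    using assms lo hi by (intro ex_between_with_sum) auto
  then obtain m where m: "\<And>i. ?lo i \<le> m i \<and> m i \<le> ?hi i" "sum m UNIV = D" by blast
  have lk: "Poly_Mapping.lookup (Abs_poly_mapping m) = m" by simp
  show ?thesis
  proof
    show "exp_deg (Abs_poly_mapping m) = D" by (simp only: lk m)
  next
    fix x
    show "Poly_Mapping.lookup (Abs_poly_mapping m) x \<le> c"
      using m(1)[of x] assms(4) by (simp only: lk) (auto split: if_splits)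
    show "x \<in> A \<Longrightarrow> Poly_Mapping.lookup (Abs_poly_mapping m) x = c"
      using m(1)[of x] assms(1) by (simp only: lk) (auto split: if_splits)
    show "x \<in> W \<Longrightarrow> Poly_Mapping.lookup (Abs_poly_mapping m) x \<le> w"
      using m(1)[of x] by (simp only: lk) (auto split: if_splits)
  qed
qed

text \<open>A monomial x^m of degree d - 2, full on A, is completed by variables outside A. For c
  \<ge> 2 two indices suffice: x^m x_i^2 times x^m x_j^2 is the square of x^m x_i x_j. For c = 1
  four distinct indices are taken.\<close>

lemma ex_isolated_pair:
  fixes A :: "'n::finite set"
  assumes c: "1 \<le> c" and A: "card A * c + 2 \<le> d" and d: "d \<le> (CARD('n) - 1) * c"
    and ne: "\<not> (c = 1 \<and> d = CARD('n) - 1)"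
  obtains g h g' h' where "g \<in> bounded_exps d c" "h \<in> bounded_exps d c"
    "g' \<in> bounded_exps d c" "h' \<in> bounded_exps d c" "g + h = g' + h'" "g' \<noteq> g" "g' \<noteq> h"
    "\<And>s. s \<in> A \<Longrightarrow> Poly_Mapping.lookup g s = c" "\<And>s. s \<in> A \<Longrightarrow> Poly_Mapping.lookup h s = c"
proof -
  have "card A * c < (CARD('n) - 1) * c" using A d by linarith
  then have cA: "card A + 2 \<le> CARD('n)" by auto
  have A': "card A * c \<le> d - 2" using A by simp
  have cc: "card (- A) = CARD('n) - card A" 
    by (simp add: Compl_eq_Diff_UNIV card_Diff_subset)
  have "\<exists>m i j k l. i \<noteq> j \<and> k \<noteq> l \<and> {i, j, k, l} \<inter> A = {} \<and> exp_deg m = d - 2 \<and>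
      (\<forall>s\<in>A. Poly_Mapping.lookup m s = c) \<and>
      (\<forall>u\<in>{i, j}. \<forall>v\<in>{k, l}. \<forall>x. Poly_Mapping.lookup (m + unit_exp u + unit_exp v) x \<le> c)"
  proof (cases "c = 1")
    case False
    with c have c2: "2 \<le> c" by simp
    have "2 \<le> card (- A)" using cA cc by simp
    then obtain W where W: "W \<subseteq> - A" "card W = 2" by (rule obtain_subset_with_card_n)
    have W': "A \<inter> W = {}" using W by blast
    from W obtain i j where ij: "W = {i, j}" "i \<noteq> j" by (meson card_2_iff)
    obtain n' where n': "CARD('n) = n' + 2" using cA by (metis add.commute le_Suc_ex le_add2 le_trans)
    obtain c' where c': "c = c' + 2" using c2 by (metis add.commute le_Suc_ex)
    \<comment> \<open>The right side is (n - 2) c + 2 (c - 2) = n c - 4, which is at least (n - 1) c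
      - 2 because c \<ge> 2.\<close>
    have D: "d - 2 \<le> (CARD('n) - card W) * c + card W * (c - 2)"
      using d W(2) by (simp add: n' c' algebra_simps)
    obtain m where m: "exp_deg m = d - 2" "\<And>x. Poly_Mapping.lookup m x \<le> c"
      "\<And>x. x \<in> A \<Longrightarrow> Poly_Mapping.lookup m x = c"
      "\<And>x. x \<in> W \<Longrightarrow> Poly_Mapping.lookup m x \<le> c - 2"
      using ex_bounded_exp[OF W' A' D diff_le_self] by blast
    have bd: "Poly_Mapping.lookup (m + unit_exp u + unit_exp v) x \<le> c"
      if "u \<in> {i, j}" "v \<in> {i, j}" for u v x
      using m(2)[of x] m(4)[of x] that c2 ij(1)
      by (auto simp: lookup_add lookup_unit_exp split: if_splits)
    have disj: "{i, j, i, j} \<inter> A = {}" using W ij by auto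
    show ?thesis
      by (rule exI[of _ m], rule exI[of _ i], rule exI[of _ j], rule exI[of _ i], rule exI[of _ j],
          intro conjI ballI allI) (fact ij(2) disj m(1) m(3) bd)+
  next
    case c1: True
    \<comment> \<open>As d = n - 1 is excluded, card A \<le> d - 2 \<le> n - 4, which leaves four
      indices.\<close>
    have d1: "d \<le> CARD('n) - 2" using d c1 ne by simp
    then have "4 \<le> card (- A)" using A c1 cc by simp
    then obtain W where W: "W \<subseteq> - A" "card W = 4" by (rule obtain_subset_with_card_n)
    have W': "A \<inter> W = {}" using W by blast
    have "2 \<le> card W" using W by simp
    then obtain W1 where W1: "W1 \<subseteq> W" "card W1 = 2" by (rule obtain_subset_with_card_n)
    then have "card (W - W1) = 2" using W by (simp add: card_Diff_subset)
    then obtain k l where kl: "W - W1 = {k, l}" "k \<noteq> l" by (meson card_2_iff)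
    obtain i j where ij: "W1 = {i, j}" "i \<noteq> j" using W1(2) by (meson card_2_iff)
    have D: "d - 2 \<le> (CARD('n) - card W) * c + card W * 0"
      using d1 W(2) c1 by simp
    obtain m where m: "exp_deg m = d - 2" "\<And>x. Poly_Mapping.lookup m x \<le> c"
      "\<And>x. x \<in> A \<Longrightarrow> Poly_Mapping.lookup m x = c" "\<And>x. x \<in> W \<Longrightarrow> Poly_Mapping.lookup m x \<le> 0"
      using ex_bounded_exp[OF W' A' D le0] by blast
    have bd: "Poly_Mapping.lookup (m + unit_exp u + unit_exp v) x \<le> c"
      if "u \<in> {i, j}" "v \<in> {k, l}" for u v x
    proof -
      have "u \<in> W" "v \<in> W" "u \<noteq> v" using that W1 unfolding ij(1)[symmetric] kl(1)[symmetric] by auto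
      then show ?thesis
        using m(2)[of x] m(4)[of x] c1 by (auto simp: lookup_add lookup_unit_exp)
    qed
    have disj: "{i, j, k, l} \<inter> A = {}" using W W1 ij(1) kl(1) by blast
    show ?thesis
      by (rule exI[of _ m], rule exI[of _ i], rule exI[of _ j], rule exI[of _ k], rule exI[of _ l],
          intro conjI ballI allI) (fact ij(2) kl(2) disj m(1) m(3) bd)+
  qed
  then obtain m i j k l where ijkl: "i \<noteq> j" "k \<noteq> l" "{i, j, k, l} \<inter> A = {}" and m: "exp_deg m = d - 2"
      "\<forall>s\<in>A. Poly_Mapping.lookup m s = c"
    and bd: "\<forall>u\<in>{i, j}. \<forall>v\<in>{k, l}. \<forall>x. Poly_Mapping.lookup (m + unit_exp u + unit_exp v) x \<le> c"
    by blast
  have inB: "m + unit_exp u + unit_exp v \<in> bounded_exps d c" if "u \<in> {i, j}" "v \<in> {k, l}" for u v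
  proof -
    have "exp_deg (m + unit_exp u + unit_exp v) = d"
      using m(1) A exp_deg_unit_exp[of u] exp_deg_unit_exp[of v]
      by (simp add: lookup_add sum.distrib)
    moreover have "\<forall>x. Poly_Mapping.lookup (m + unit_exp u + unit_exp v) x \<le> c"
      using bd that by blast
    ultimately show ?thesis unfolding bounded_exps_def by blast
  qed
  have unit_inj: "unit_exp x \<noteq> unit_exp y" if "x \<noteq> y" for x y :: 'n
  proof
    assume "unit_exp x = unit_exp y"
    then have "Poly_Mapping.lookup (unit_exp x) x = Poly_Mapping.lookup (unit_exp y) x" by (rule arg_cong)
    with that show False by (simp only: lookup_unit_exp) simp
  qed
  show ?thesis
  proof (rule that[of "m + unit_exp i + unit_exp k" "m + unit_exp j + unit_exp l"
        "m + unit_exp j + unit_exp k" "m + unit_exp i + unit_exp l"])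
    show "m + unit_exp i + unit_exp k + (m + unit_exp j + unit_exp l)
        = m + unit_exp j + unit_exp k + (m + unit_exp i + unit_exp l)"
      by (simp only: ac_simps)
    show "m + unit_exp j + unit_exp k \<noteq> m + unit_exp i + unit_exp k"
      using unit_inj[OF ijkl(1)] by (simp add: eq_commute)
    show "m + unit_exp j + unit_exp k \<noteq> m + unit_exp j + unit_exp l"
      using unit_inj[OF ijkl(2)] by simp
  qed (use inB ijkl m in \<open>auto simp: lookup_add lookup_unit_exp\<close>)
qed

section \<open>The Veronese ideal and its conductor\<close>

lemma veronese_eq: "veronese d c = ideal_gen (mmon ` bounded_exps d c)"
proof -
  have "{\<Prod>i\<in>UNIV. mvar i ^ \<alpha> i | \<alpha> :: 'a \<Rightarrow> nat. (\<Sum>i\<in>UNIV. \<alpha> i) = d \<and> (\<forall>i. \<alpha> i \<le> c)}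
      = (mmon ` bounded_exps d c :: ('a, 'b) mpol set)" (is "?L = ?R")
  proof
    show "?L \<subseteq> ?R"
    proof
      fix F assume "F \<in> ?L"
      then obtain \<alpha> :: "'a \<Rightarrow> nat" where \<alpha>: "F = (\<Prod>i\<in>UNIV. mvar i ^ \<alpha> i)"
        "(\<Sum>i\<in>UNIV. \<alpha> i) = d" "\<forall>i. \<alpha> i \<le> c" by blast
      have "Poly_Mapping.lookup (Abs_poly_mapping \<alpha>) = \<alpha>" by simp
      then have "F = mmon (Abs_poly_mapping \<alpha>)" "Abs_poly_mapping \<alpha> \<in> bounded_exps d c"
        using \<alpha> prod_mvar_power[of "Abs_poly_mapping \<alpha>"] by (simp_all add: bounded_exps_def)
      then show "F \<in> ?R" by blast
    qed
    show "?R \<subseteq> ?L"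
    proof
      fix F assume "F \<in> ?R"
      then obtain a where a: "F = mmon a" "a \<in> bounded_exps d c" by blast
      then show "F \<in> ?L"
        unfolding a(1) prod_mvar_power[symmetric] by (auto simp: bounded_exps_def)
    qed
  qed
  then show ?thesis by (simp only: veronese_def)
qed

lemma exp_deg_squarefree_exp: "exp_deg (squarefree_exp (S :: 'n::finite set)) = card S"
  by (simp add: lookup_squarefree_exp sum.inter_restrict[symmetric])

lemma bounded_exps_1E:
  assumes "g \<in> bounded_exps q 1"
  obtains S where "g = squarefree_exp S" "card S = q"
proof
  have le: "Poly_Mapping.lookup g x \<le> 1" for x using bounded_expsD(2)[OF assms] .
  show eq: "g = squarefree_exp (Poly_Mapping.keys g)"
    by (rule poly_mapping_eqI)
      (use le in \<open>auto simp: lookup_squarefree_exp in_keys_iff intro: le_antisym\<close>)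
  have "q = exp_deg (squarefree_exp (Poly_Mapping.keys g))"
    using bounded_expsD(1)[OF assms] eq by simp
  then show "card (Poly_Mapping.keys g) = q"
    by (simp only: exp_deg_squarefree_exp)
qed

lemma squarefree_exp_bounded: "card S = q \<Longrightarrow> squarefree_exp S \<in> bounded_exps q 1"
  using exp_deg_squarefree_exp[of S] unfolding bounded_exps_def
  by (simp add: lookup_squarefree_exp)

text \<open>Both cases allow S to be empty, and then x_S = 1 carries J into L.\<close>

lemma (in veronese_generators) linear_type:
  assumes "(d, c) = (CARD('n) - 1, 1) \<or> (d, c) = (1, 1)"
  shows "linear_type f"
proof -
  have S: "d \<le> card ({} :: 'n set) * c + 1 \<or> c = 1 \<and> d + 1 = CARD('n)"
    using assms by auto
  have "F \<in> sym_ideal f" if "F \<in> rees_ideal f" for F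
    using squarefree_mult_rees_ideal[OF S that] by (simp add: squarefree_exp_def mconst_1)
  with sym_ideal_le_rees_ideal[of f] show ?thesis
    by (auto simp: linear_type_def)
qed

text \<open>The number q = (d - 2) div c + 1 is the least with d \<le> q c + 1. Hence x_S lies in
  the conductor for every S of size q, while monomials in fewer variables are excluded by an
  isolated pair.\<close>

lemma (in veronese_generators) conductor_eq:
  assumes c: "1 \<le> c" "2 \<le> d" "d \<le> (CARD('n) - 1) * c"
    and ne: "\<not> (c = 1 \<and> d = CARD('n) - 1)"
  shows "conductor f = veronese ((d - 2) div c + 1) 1"
proof
  let ?q = "(d - 2) div c + 1"
  show "veronese ?q 1 \<subseteq> conductor f"
  proof
    fix r :: "('n, 'k) mpol" assume "r \<in> veronese ?q 1"
    then obtain b where b: "r = (\<Sum>g\<in>bounded_exps ?q 1. b g * mmon g)"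
      unfolding veronese_eq by (rule ideal_gen_imageE) (rule finite_bounded_exps)
    have "mconst (b g) * (mconst (mmon g) * F) \<in> sym_ideal f"
      if "g \<in> bounded_exps ?q 1" "F \<in> rees_ideal f" for g F
    proof -
      from that(1) obtain S where S: "g = squarefree_exp S" "card S = ?q"
        by (rule bounded_exps_1E)
      have "d - 2 < ((d - 2) div c + 1) * c"
        using c(1) dividend_less_div_times[of c "d - 2"] by simp
      then have "d \<le> card S * c + 1"
        unfolding S(2) using c(2) by linarith
      then show ?thesis
        unfolding S(1) by (intro sym_ideal_mult squarefree_mult_rees_ideal that) simp
    qed
    then have "mconst r * F \<in> sym_ideal f" if "F \<in> rees_ideal f" for F
      unfolding b mconst_sum sum_distrib_right mconst_mult mult.assoc using that
      by (intro sym_ideal_sum) blast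
    then show "r \<in> conductor f" by (simp add: conductor_def)
  qed
  show "conductor f \<subseteq> veronese ?q 1"
  proof
    fix r assume r: "r \<in> conductor f"
    \<comment> \<open>It suffices that each monomial of r involves at least q variables, hence is a
      multiple of some x_S.\<close>
    have "Poly_Mapping.single a (Poly_Mapping.lookup r a) \<in> veronese ?q 1"
      if a: "a \<in> Poly_Mapping.keys r" for a
    proof -
      have "?q \<le> card (Poly_Mapping.keys a)"
      proof (rule ccontr)
        let ?A = "Poly_Mapping.keys a"
        assume "\<not> ?thesis"
        then have "card ?A \<le> (d - 2) div c" by simp
        then have "card ?A * c \<le> (d - 2) div c * c" by (rule mult_le_mono1)
        also have "\<dots> \<le> d - 2" by simp
        finally have "card ?A * c + 2 \<le> d" using c(2) by simp
        then obtain g h g' h' where "g \<in> B" "h \<in> B" "g' \<in> B" "h' \<in> B" "g + h = g' + h'"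
          "g' \<noteq> g" "g' \<noteq> h" "\<And>s. s \<in> ?A \<Longrightarrow> Poly_Mapping.lookup g s = c"
          "\<And>s. s \<in> ?A \<Longrightarrow> Poly_Mapping.lookup h s = c"
          using ex_isolated_pair[OF c(1) _ c(3) ne, of ?A] by metis
        then have "restrict_vars ?A r = 0" by (rule conductor_restrict_vars[OF r])
        \<comment> \<open>The coefficient at a survives restriction to the support of a, so it would
          have to be zero.\<close>
        then have "Poly_Mapping.lookup (restrict_vars ?A r) a = 0" by simp
        then show False using a by (simp add: lookup_restrict_vars in_keys_iff)
      qed
      then obtain S where S: "S \<subseteq> Poly_Mapping.keys a" "card S = ?q"
        by (rule obtain_subset_with_card_n)
      have "a = (a - squarefree_exp S) + squarefree_exp S"
      proof (rule poly_mapping_eqI)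
        fix x
        have "x \<in> S \<Longrightarrow> 0 < Poly_Mapping.lookup a x" using S(1) by (auto simp: in_keys_iff)
        then show "Poly_Mapping.lookup a x
            = Poly_Mapping.lookup (a - squarefree_exp S + squarefree_exp S) x"
          by (auto simp: lookup_add lookup_minus lookup_squarefree_exp)
      qed
      then have "Poly_Mapping.single a (Poly_Mapping.lookup r a)
          = Poly_Mapping.single (a - squarefree_exp S) (Poly_Mapping.lookup r a) * mmon (squarefree_exp S)"
        by (simp only: mult_single mult_1_right)
      then show ?thesis
        unfolding veronese_eq
        by (simp only:) (intro ideal_gen_mult ideal_gen_base imageI squarefree_exp_bounded S(2))
    qed
    then have "(\<Sum>a\<in>Poly_Mapping.keys r. Poly_Mapping.single a (Poly_Mapping.lookup r a)) \<in> veronese ?q 1"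
      unfolding veronese_def by (rule ideal_gen_sum)
    then show "r \<in> veronese ?q 1" by (simp only: mpol_sum_singles[symmetric])
  qed
qed

theorem theorem3p4:
  fixes f :: "'m::finite \<Rightarrow> ('n::finite, 'k::field) mpol"
    and n d c :: nat
  assumes "n = CARD('n)"
    and "1 \<le> c" and "c \<le> d" and "d \<le> (n - 1) * c"
    and "ideal_gen (range f) = veronese d c"
  shows "((d, c) = (n - 1, 1) \<or> (d, c) = (1, 1) \<longrightarrow> linear_type f) \<and>
         (\<not> ((d, c) = (n - 1, 1) \<or> (d, c) = (1, 1)) \<longrightarrow>
           (let p = \<lfloor>(real d - 2) / real c\<rfloor> in conductor f = veronese (nat (p + 1)) 1))"
proof -
  have "\<exists>a. (\<Sum>j\<in>UNIV. a j * f j) = mmon g" if "g \<in> bounded_exps d c" for g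
  proof -
    have "mmon g \<in> ideal_gen (range f)"
      unfolding assms(5) veronese_eq using that by (intro ideal_gen_base imageI)
    then obtain a where "mmon g = (\<Sum>j\<in>UNIV. a j * f j)" by (rule ideal_gen_imageE) simp
    then show ?thesis by (intro exI[of _ a]) simp
  qed
  then obtain cf where cf: "\<And>g. g \<in> bounded_exps d c \<Longrightarrow> (\<Sum>j\<in>UNIV. cf g j * f j) = mmon g"
    by metis
  have "\<exists>b. f j = (\<Sum>g\<in>bounded_exps d c. b g * mmon g)" for j
  proof -
    have "f j \<in> veronese d c"
      unfolding assms(5)[symmetric] by (intro ideal_gen_base rangeI)
    then obtain b where "f j = (\<Sum>g\<in>bounded_exps d c. b g * mmon g)"
      unfolding veronese_eq by (rule ideal_gen_imageE) (rule finite_bounded_exps)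
    then show ?thesis by blast
  qed
  then obtain bf where "\<And>j. f j = (\<Sum>g\<in>bounded_exps d c. bf j g * mmon g)" by metis
  with cf interpret veronese_generators f d c cf bf by unfold_locales
  have "conductor f = veronese (nat (\<lfloor>(real d - 2) / real c\<rfloor> + 1)) 1"
    if ne: "\<not> ((d, c) = (n - 1, 1) \<or> (d, c) = (1, 1))"
  proof -
    \<comment> \<open>d = 1 would force c = 1, an excluded case. With d \<ge> 2 the truncated
      difference d - 2 agrees with the real one.\<close>
    have d: "2 \<le> d" using assms(2,3) ne by (cases "d = 1") auto
    then have "\<lfloor>(real d - 2) / real c\<rfloor> = int ((d - 2) div c)"
      using floor_divide_of_nat_eq[of "d - 2" c, where ?'a = real] by (simp add: of_nat_diff)
    then have "nat (\<lfloor>(real d - 2) / real c\<rfloor> + 1) = (d - 2) div c + 1" by simp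
    moreover have "\<not> (c = 1 \<and> d = CARD('n) - 1)" using ne assms(1) by auto
    ultimately show ?thesis
      using conductor_eq[OF assms(2) d] assms(1,4) by simp
  qed
  then show ?thesis
    using linear_type assms(1) by (simp add: Let_def)
qed

end
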